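(* Let $(R,\mathfrak m,k)$ be a complete local one-dimensional domain containing an infinite field $k$, so that $\overline R=k[[t]]$. Let $e(R)=e$ and let $v$ be the valuation defining $\overline R$. (1) $\#\mathrm{T}(R)=2$ if and only if $R=k[[t^e,\dots,t^{2e-1}]]$. (2) The following are equivalent: (a) $\#\mathrm{T}(R)=3$. (b) $R=k[[\alpha t^e,t^c,t^{c+1},\dots,\widehat{t^{2e}},\dots,t^{c+e-1}]]$ where $\alpha$ is a unit of $k[[t]]$ and $e+2\le c\le 2e$. (c) $\ell(R/\mathfrak c)=2$.
   Context: All rings are commutative Noetherian with unity and all modules are finitely generated. In the notation $(R,\mathfrak m,k)$, $\mathfrak m$ is the maximal ideal and $k$ the residue field of $R$. $\overline R$ is the integral closure of $R$ in its total quotient ring $Q(R)$ (here the fraction field), and $\mathfrak c=R:\overline R=\{a\in Q(R): a\overline R\subseteq R\}$ is the conductor ideal. $e(R)$ is the Hilbert-Samuel multiplicity of $R$ with respect to $\mathfrak m$, and $\ell$ denotes length. The trace ideal $\mathrm{tr}(M)$ of an $R$-module $M$ is the image of the map $\mathrm{Hom}_R(M,R)\otimes_R M\to R$, $\phi\otimes x\mapsto\phi(x)$; an ideal $I$ is a trace ideal if $I=\mathrm{tr}(M)$ for some module $M$ (equivalently $I=\mathrm{tr}(I)$). An ideal of $R$ is regular if it contains a nonzerodivisor. $\mathrm{T}(R)$ is the set of regular trace ideals of $R$ (including $R$ itself), and $\#$ denotes cardinality. The hat in $\widehat{t^{2e}}$ means that this generator is omitted from the list.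
   Formalization: In (1) the right-hand side also requires e ≥ 2: for R = k[[t]] (e = 1) one has R = k[[t^e,…,t^{2e-1}]] but #T(R) = 1, so (1) fails there as written; R̄ = k[[t]] is taken as a hypothesis. *)

theory Defs
  imports
    "HOL-Analysis.Analysis"
    "HOL-Algebra.Algebra"
    "HOL-Algebra.Algebraic_Closure_Type"
    "HOL-Computational_Algebra.Formal_Laurent_Series"
begin

section \<open>Local rings, dimension, completeness\<close>

definition local_ring :: "('a, 'b) ring_scheme \<Rightarrow> 'a set \<Rightarrow> bool" where
  "local_ring R \<mm> \<longleftrightarrow> cring R \<and> maximalideal \<mm> R \<and> (\<forall>J. maximalideal J R \<longrightarrow> J = \<mm>)"

definition krull_dim :: "('a, 'b) ring_scheme \<Rightarrow> enat" where
  "krull_dim R = (SUP n \<in> {n. \<exists>P :: nat \<Rightarrow> 'a set.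
      (\<forall>i\<le>n. primeideal (P i) R) \<and> (\<forall>i<n. P i \<subset> P (Suc i))}. enat n)"

abbreviation ideal_power :: "('a, 'b) ring_scheme \<Rightarrow> 'a set \<Rightarrow> nat \<Rightarrow> 'a set" where
  "ideal_power R I n \<equiv> I [^]\<^bsub>ideals_set R\<^esub> n"

text \<open>The canonical map from \<open>R\<close> to the inverse limit of the rings \<open>R / I^n\<close> is injective
  (first conjunct) and surjective (second conjunct).\<close>

definition adically_complete :: "('a, 'b) ring_scheme \<Rightarrow> 'a set \<Rightarrow> bool" where
  "adically_complete R I \<longleftrightarrow>
     (\<Inter>n. ideal_power R I n) = {\<zero>\<^bsub>R\<^esub>} \<and>
     (\<forall>s :: nat \<Rightarrow> 'a.
        (\<forall>n. s n \<in> carrier R \<and> s (Suc n) \<ominus>\<^bsub>R\<^esub> s n \<in> ideal_power R I n) \<longrightarrow>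
        (\<exists>x \<in> carrier R. \<forall>n. x \<ominus>\<^bsub>R\<^esub> s n \<in> ideal_power R I n))"

section \<open>Length and Hilbert--Samuel multiplicity\<close>

definition module_length :: "('a, 'c) ring_scheme \<Rightarrow> ('a, 'b, 'd) module_scheme \<Rightarrow> enat" where
  "module_length R M = (SUP n \<in> {n. \<exists>N :: nat \<Rightarrow> 'b set.
      (\<forall>i\<le>n. submodule (N i) R M) \<and> (\<forall>i<n. N i \<subset> N (Suc i))}. enat n)"

definition quotient_module :: "('a, 'b) ring_scheme \<Rightarrow> 'a set \<Rightarrow> ('a, 'a set) module" where
  "quotient_module R I =
     \<lparr>carrier = carrier (R Quot I), monoid.mult = monoid.mult (R Quot I),
      monoid.one = \<one>\<^bsub>R Quot I\<^esub>, ring.zero = \<zero>\<^bsub>R Quot I\<^esub>, ring.add = ring.add (R Quot I),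
      module.smult = (\<lambda>a C. (I +>\<^bsub>R\<^esub> a) \<otimes>\<^bsub>R Quot I\<^esub> C)\<rparr>"

definition hilbert_samuel_multiplicity :: "('a, 'b) ring_scheme \<Rightarrow> 'a set \<Rightarrow> real" where
  "hilbert_samuel_multiplicity R I = (let d = the_enat (krull_dim R) in
     lim (\<lambda>n. fact d * real (the_enat (module_length R (quotient_module R (ideal_power R I n))))
               / real n ^ d))"

section \<open>Trace ideals\<close>

definition finitely_generated_module ::
  "('a, 'c) ring_scheme \<Rightarrow> ('a, 'b, 'd) module_scheme \<Rightarrow> bool" where
  "finitely_generated_module R M \<longleftrightarrow> Module.module R M \<and>
     (\<exists>S. finite S \<and> S \<subseteq> carrier M \<and> (\<forall>N. submodule N R M \<and> S \<subseteq> N \<longrightarrow> N = carrier M))"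

definition linear_forms ::
  "('a, 'c) ring_scheme \<Rightarrow> ('a, 'b, 'd) module_scheme \<Rightarrow> ('b \<Rightarrow> 'a) set" where
  "linear_forms R M = {\<phi>. \<phi> \<in> carrier M \<rightarrow> carrier R \<and>
     (\<forall>x\<in>carrier M. \<forall>y\<in>carrier M. \<phi> (x \<oplus>\<^bsub>M\<^esub> y) = \<phi> x \<oplus>\<^bsub>R\<^esub> \<phi> y) \<and>
     (\<forall>a\<in>carrier R. \<forall>x\<in>carrier M. \<phi> (a \<odot>\<^bsub>M\<^esub> x) = a \<otimes>\<^bsub>R\<^esub> \<phi> x)}"

text \<open>An element of \<open>Hom(M, R) \<otimes> M\<close> is a finite sum of elementary tensors, so the image of the
  evaluation map consists of the finite sums of values \<open>\<phi> x\<close>.\<close>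

definition module_trace ::
  "('a, 'c) ring_scheme \<Rightarrow> ('a, 'b, 'd) module_scheme \<Rightarrow> 'a set" where
  "module_trace R M = {\<Oplus>\<^bsub>R\<^esub>i\<in>{..<n}. \<phi> i (x i) | (n :: nat) \<phi> x.
     \<forall>i<n. \<phi> i \<in> linear_forms R M \<and> x i \<in> carrier M}"

text \<open>HOL cannot quantify over the type carrying \<open>M\<close>, so \<open>M\<close> is taken to live on the type of ring
  elements. For an infinite ring this loses nothing: a finitely generated \<open>R\<close>-module is an image
  of some \<open>R^n\<close>, which is equipotent to \<open>R\<close>, so it is isomorphic to a module whose carrier is a
  subset of \<open>R\<close>.\<close>

definition trace_ideal :: "'a set \<Rightarrow> ('a, 'c) ring_scheme \<Rightarrow> bool" where
  "trace_ideal I R \<longleftrightarrow>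
     (\<exists>M :: ('a, 'a) module. finitely_generated_module R M \<and> I = module_trace R M)"

definition regular_ideal :: "'a set \<Rightarrow> ('a, 'c) ring_scheme \<Rightarrow> bool" where
  "regular_ideal I R \<longleftrightarrow> ideal I R \<and>
     (\<exists>x\<in>I. \<forall>y\<in>carrier R. x \<otimes>\<^bsub>R\<^esub> y = \<zero>\<^bsub>R\<^esub> \<longrightarrow> y = \<zero>\<^bsub>R\<^esub>)"

definition regular_trace_ideals :: "('a, 'c) ring_scheme \<Rightarrow> 'a set set" where
  "regular_trace_ideals R = {I. regular_ideal I R \<and> trace_ideal I R}"

section \<open>Subrings of a field: fractions, integral closure, conductor\<close>

abbreviation ring_on :: "'a::ring_1 set \<Rightarrow> 'a ring" where
  "ring_on R \<equiv> ring_of_type_algebra\<lparr>carrier := R\<rparr>"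

definition fractions :: "'a::field set \<Rightarrow> 'a set" where
  "fractions R = {a / b | a b. a \<in> R \<and> b \<in> R \<and> b \<noteq> 0}"

definition integral_over :: "'a::field set \<Rightarrow> 'a \<Rightarrow> bool" where
  "integral_over R x \<longleftrightarrow> (\<exists>p :: 'a poly.
     (\<forall>i. Polynomial.coeff p i \<in> R) \<and> Polynomial.lead_coeff p = 1 \<and> poly p x = 0)"

definition integral_closure :: "'a::field set \<Rightarrow> 'a set" where
  "integral_closure R = {x \<in> fractions R. integral_over R x}"

definition conductor :: "'a::field set \<Rightarrow> 'a set" where
  "conductor R = {a \<in> fractions R. \<forall>x \<in> integral_closure R. a * x \<in> R}"

section \<open>Power series in finitely many power series\<close>

text \<open>\<open>power_series_in G\<close> is \<open>k[[g | g \<in> G]]\<close> for a finite set \<open>G\<close> of power series without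
  constant term: the convergent series of terms \<open>a u * (\<Prod>g\<in>G. g ^ u g)\<close>, where the exponent
  functions \<open>u\<close> vanish off \<open>G\<close>. Convergence is with respect to the metric on \<^typ>\<open>'k fps\<close>, which
  is the \<open>t\<close>-adic one.\<close>

definition power_series_in :: "'k::field fps set \<Rightarrow> 'k fps set" where
  "power_series_in G = {f. \<exists>a :: ('k fps \<Rightarrow> nat) \<Rightarrow> 'k.
     ((\<lambda>u. fps_const (a u) * (\<Prod>g\<in>G. g ^ u g)) has_sum f) {u. \<forall>g. g \<notin> G \<longrightarrow> u g = 0}}"

end

theory Submission
  imports Defs
begin

text \<open>Completeness gives \<open>R = A\<close> for a subalgebra \<open>A\<close> of \<open>k[[t]]\<close> that contains some
  \<open>t^N k[[t]]\<close>: if \<open>a\<close> has positive order \<open>n\<close>, then \<open>k[[t]]\<close> is generated over \<open>k[[a]] \<subseteq> R\<close>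
  by \<open>1, t, \<dots>, t^(n-1)\<close>, and these have a common denominator. From then on everything is read off
  the set \<open>v(A)\<close> of orders. Let \<open>c\<close> be its conductor exponent.

  A regular ideal \<open>I\<close> is a trace ideal iff \<open>q I \<subseteq> R\<close> implies \<open>q I \<subseteq> I\<close> for all fractions \<open>q\<close>.
  Hence trace ideals contain the conductor, and each \<open>{f \<in> A. v(f) \<ge> n}\<close> with \<open>n \<le> c\<close> is one,
  because \<open>q\<close> then has order at least \<open>0\<close>. This gives \<open>\<ell>(R/\<cc>) + 1\<close> trace ideals, where
  \<open>\<ell>(R/\<cc>) = #(v(A) \<inter> [0,c))\<close>, and for \<open>\<ell>(R/\<cc>) \<le> 2\<close> there are no others. The two power series
  presentations are the cases \<open>v(A) = {0} \<union> [e,\<infinity>)\<close> and \<open>v(A) = {0,e} \<union> [c,\<infinity>)\<close>.\<close>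

section \<open>Orders of power series\<close>

text \<open>Orders decide everything because the leading terms of a given order form a line over
  \<open>k\<close>: two series of equal order differ, up to a constant factor, by one of higher
  order. So for nested subspaces containing a common \<open>t^M k[[t]]\<close>, equality and
  relative length are visible on the sets of orders. \<open>fps_subspace_subset_by_vals\<close> is
  the tool behind the conductor exponent, the classification of trace ideals and the length formula.
  The count stops at two orders below \<open>c\<close> because from three on an ideal containing the
  conductor can start at a positive order and omit a later one, so it need not be cut out by an
  order bound. The order ideals then still number at least four, which excludes the counts 2 and 3.
  The multiplicity is the least positive order \<open>e\<close>, since the colength of the
  \<open>n\<close>-th power of the maximal ideal is \<open>e n\<close> up to a bounded error. The
  bounds in (b) come from the orders: \<open>c - 1\<close> is a gap but \<open>e\<close> is not, so
  \<open>e + 2 \<le> c\<close>; and \<open>2 e\<close> is an order, so \<open>c \<le> 2 e\<close>.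
  The condition \<open>2 \<le> e\<close> in (1) separates off \<open>k[[t]]\<close>, where
  \<open>c = 0\<close> and the ring itself is the only regular trace ideal.\<close>

definition vals :: "'k::zero fps set \<Rightarrow> nat set" where
  "vals S = subdegree ` (S - {0})"

definition fps_subspace :: "'k::field fps set \<Rightarrow> bool" where
  "fps_subspace I \<longleftrightarrow> 0 \<in> I \<and> (\<forall>f\<in>I. \<forall>g\<in>I. f + g \<in> I) \<and> (\<forall>c. \<forall>f\<in>I. fps_const c * f \<in> I)"

lemma vals_mono: "I \<subseteq> J \<Longrightarrow> vals I \<subseteq> vals J"
  by (auto simp: vals_def)

lemma fps_subspace_diff:
  assumes "fps_subspace I" "f \<in> I" "g \<in> I"
  shows "f - fps_const c * g \<in> I"
proof -
  have "f + fps_const (-c) * g \<in> I"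
    using assms by (auto simp: fps_subspace_def)
  then show ?thesis
    by (simp flip: fps_const_neg)
qed

text \<open>Cancelling the leading term of \<open>f\<close> against some \<open>g\<close> of equal
  order raises the order of the remainder; from order \<open>M\<close> on every series is in
  \<open>I\<close>, so the process stops. Membership of \<open>g\<close> in \<open>J\<close> keeps
  the remainder in \<open>J\<close>, which takes the place of an inclusion between the two
  spaces.\<close>

lemma fps_subspace_subset_by_vals:
  assumes I: "fps_subspace I" and J: "fps_subspace J"
    and M: "\<And>f. fps_X ^ M * f \<in> I"
    and v: "\<And>f. f \<in> J \<Longrightarrow> f \<noteq> 0 \<Longrightarrow> \<exists>g\<in>I \<inter> J. g \<noteq> 0 \<and> subdegree g = subdegree f"
  shows "J \<subseteq> I"
proof -
  \<comment> \<open>Downward induction on the vanishing order, written \<open>M - d\<close>; at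
    \<open>d = M\<close> the vanishing condition is empty.\<close>
  have "f \<in> I" if "f \<in> J" "\<forall>i<M - d. fps_nth f i = 0" for f d
    using that
  proof (induction d arbitrary: f)
    case 0
    then have "fps_cutoff M f = 0"
      by (simp add: fps_eq_iff)
    then have "f = fps_X ^ M * fps_shift M f"
      using fps_shift_cutoff'[of M f] by simp
    then show ?case
      using M by metis
  next
    case (Suc d)
    show ?case
    proof (cases "f = 0")
      case True
      then show ?thesis using I by (simp add: fps_subspace_def)
    next
      case False
      obtain g where g: "g \<in> I" "g \<in> J" "g \<noteq> 0" "subdegree g = subdegree f"
        using v[OF Suc.prems(1) False] by blast
      define c where "c = fps_nth f (subdegree f) / fps_nth g (subdegree f)"
      define h where "h = f - fps_const c * g"
      have "M - Suc d \<le> subdegree f"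
        using Suc.prems(2) False by (meson linorder_not_le nth_subdegree_nonzero)
      moreover have "fps_nth h i = 0" if i: "i \<le> subdegree f" for i
      proof (cases "i = subdegree f")
        case True
        have "fps_nth g (subdegree f) \<noteq> 0"
          using g(3,4) nth_subdegree_nonzero by metis
        then show ?thesis
          unfolding h_def c_def True by simp
      next
        case False
        then have "fps_nth f i = 0" "fps_nth g i = 0"
          using i g(4) by (metis nth_less_subdegree_zero le_neq_implies_less)+
        then show ?thesis
          unfolding h_def fps_sub_nth fps_mult_left_const_nth by simp
      qed
      ultimately have "\<forall>i<M - d. fps_nth h i = 0"
        by auto
      then have "h \<in> I"
        using Suc.IH[of h] fps_subspace_diff[OF J Suc.prems(1) g(2)] by (simp add: h_def)
      moreover have "f = h + fps_const c * g"
        by (simp add: h_def)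
      ultimately show ?thesis
        using I g(1) by (simp add: fps_subspace_def)
    qed
  qed
  from this[of _ M] show ?thesis by auto
qed

text \<open>This turns a strict chain of subspaces into a strict chain of order sets, and so bounds
  lengths by counting orders.\<close>

lemma fps_subspace_psubset_vals:
  assumes "fps_subspace I" "fps_subspace J" "I \<subset> J" "\<And>f. fps_X ^ M * f \<in> I"
  shows "vals I \<subset> vals J"
proof -
  have "vals I \<noteq> vals J"
  proof
    assume eq: "vals I = vals J"
    have "J \<subseteq> I"
    proof (rule fps_subspace_subset_by_vals[OF assms(1,2,4)])
      fix f assume "f \<in> J" "f \<noteq> 0"
      then have "subdegree f \<in> vals I"
        unfolding eq by (auto simp: vals_def)
      then show "\<exists>g\<in>I \<inter> J. g \<noteq> 0 \<and> subdegree g = subdegree f"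
        using assms(3) by (auto simp: vals_def)
    qed
    with assms(3) show False by blast
  qed
  then show ?thesis using vals_mono[of I J] assms(3) by blast
qed

lemma fps_eq_X_power_mult:
  assumes "\<And>i. i < n \<Longrightarrow> fps_nth f i = 0"
  shows "f = fps_X ^ n * fps_shift n f"
proof -
  have "fps_cutoff n f = 0"
    using assms by (simp add: fps_eq_iff)
  then show ?thesis
    using fps_shift_cutoff'[of n f] by simp
qed

text \<open>For finite \<open>G\<close> this is the additive monoid generated by the orders of the
  nonzero elements of \<open>G\<close>. It is expressed through monomials so that each order comes
  with an exponent function realising it.\<close>

definition monomial_orders :: "'k::field fps set \<Rightarrow> nat set" where
  "monomial_orders G = {n. \<exists>u. (\<forall>g. g \<notin> G \<longrightarrow> u g = 0) \<and> (\<Prod>g\<in>G. g ^ u g) \<noteq> 0 \<and>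
     subdegree (\<Prod>g\<in>G. g ^ u g) = n}"

text \<open>\<open>A\<close> is closed in the \<open>t\<close>-adic topology, and conversely monomials realising
  all its orders suffice to expand every element by successive subtraction of leading terms.\<close>

lemma power_series_in_eqI:
  fixes A :: "'k::field fps set"
  assumes A: "fps_subspace A" and mult: "\<And>f g. f \<in> A \<Longrightarrow> g \<in> A \<Longrightarrow> f * g \<in> A" and one: "1 \<in> A"
    and N: "\<And>f. fps_X ^ N * f \<in> A"
    and G: "G \<subseteq> A" "finite G"
    and v: "vals A \<subseteq> monomial_orders G"
  shows "power_series_in G = A"
proof
  define m where "m = (\<lambda>u :: 'k fps \<Rightarrow> nat. \<Prod>g\<in>G. g ^ u g)"
  define U where "U = {u :: 'k fps \<Rightarrow> nat. \<forall>g. g \<notin> G \<longrightarrow> u g = 0}"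
  have mem_m: "m u \<in> A" for u
  proof -
    have pow: "g ^ n \<in> A" if "g \<in> A" for g n
      using that by (induction n) (auto intro: mult one)
    show ?thesis
      unfolding m_def using G(2,1) by (induction G rule: finite_induct) (auto intro: mult one pow)
  qed
  show "power_series_in G \<subseteq> A"
  proof
    fix f assume "f \<in> power_series_in G"
    then obtain a where a: "((\<lambda>u. fps_const (a u) * m u) has_sum f) U"
      unfolding power_series_in_def m_def U_def by blast
    define S where "S = (\<lambda>F. \<Sum>u\<in>F. fps_const (a u) * m u)"
    have "filterlim S (nhds f) (finite_subsets_at_top U)"
      using a unfolding has_sum_def S_def .
    then have ev: "\<forall>\<^sub>F F in finite_subsets_at_top U. fps_nth (S F) n = fps_nth f n" for n
      by (simp only: tendsto_fps_iff)
    have "\<forall>\<^sub>F F in finite_subsets_at_top U. \<forall>n\<in>{..<N}. fps_nth (S F) n = fps_nth f n"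
      by (rule eventually_ball_finite) (simp_all add: ev)
    \<comment> \<open>Only the coefficients below \<open>N\<close> have to agree, so one finite
      partial sum is enough: the rest of \<open>f\<close> lies in \<open>t^N k[[t]]\<close>, hence
      in \<open>A\<close>.\<close>
    then obtain F where F: "finite F" "\<And>n. n < N \<Longrightarrow> fps_nth (S F) n = fps_nth f n"
      unfolding eventually_finite_subsets_at_top by (metis order_refl lessThan_iff)
    have s: "S F \<in> A"
      unfolding S_def using F(1) A mem_m by (induction F rule: finite_induct) (auto simp: fps_subspace_def)
    define h where "h = f - S F"
    have "h = fps_X ^ N * fps_shift N h"
      by (rule fps_eq_X_power_mult) (use F(2) in \<open>auto simp: h_def\<close>)
    then have "h \<in> A" using N by metis
    moreover have "f = h + S F" by (simp add: h_def)
    ultimately show "f \<in> A" using s A by (simp add: fps_subspace_def)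
  qed
  show "A \<subseteq> power_series_in G"
  proof
    fix f assume f: "f \<in> A"
    obtain u where u: "\<And>n. n \<in> vals A \<Longrightarrow> u n \<in> U \<and> m (u n) \<noteq> 0 \<and> subdegree (m (u n)) = n"
      using v unfolding m_def U_def monomial_orders_def subset_iff mem_Collect_eq by metis
    \<comment> \<open>The multiple of the chosen monomial that removes the coefficient at
      \<open>n\<close>. The value 0 off \<open>vals A\<close> is harmless: a remainder in
      \<open>A\<close> vanishing below \<open>n\<close> also vanishes at \<open>n\<close> when
      \<open>n\<close> is no order.\<close>
    define step where "step = (\<lambda>n h. if n \<in> vals A then fps_nth h n / fps_nth (m (u n)) n else 0)"
    define r where "r = rec_nat f (\<lambda>n h. h - fps_const (step n h) * m (u n))"
    have r0: "r 0 = f" and rS: "r (Suc n) = r n - fps_const (step n (r n)) * m (u n)" for n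
      by (simp_all add: r_def)
    have rA: "r n \<in> A" for n
      by (induction n) (auto simp: r0 rS f intro: fps_subspace_diff[OF A _ mem_m])
    have rn: "\<forall>i<n. fps_nth (r n) i = 0" for n
    proof (induction n)
      case (Suc n)
      show ?case
      proof (intro allI impI)
        fix i assume i: "i < Suc n"
        show "fps_nth (r (Suc n)) i = 0"
        proof (cases "n \<in> vals A")
          case True
          then have "fps_nth (m (u n)) n \<noteq> 0"
            using u[OF True] nth_subdegree_nonzero by metis
          moreover have "fps_nth (m (u n)) i = 0" if "i < n"
            using u[OF True] that by (metis nth_less_subdegree_zero)
          moreover have "fps_nth (r n) i = 0" if "i < n"
            using Suc.IH that by blast
          ultimately show ?thesis
            unfolding rS step_def fps_sub_nth fps_mult_left_const_nth if_P[OF True]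
            using i by (cases "i = n") simp_all
        next
          case False
          have "fps_nth (r n) n = 0"
          proof (rule ccontr)
            assume "fps_nth (r n) n \<noteq> 0"
            then have "subdegree (r n) = n" "r n \<noteq> 0"
              using Suc.IH by (auto intro: subdegreeI)
            then show False using False rA[of n] by (force simp: vals_def)
          qed
          then show ?thesis
            using i Suc.IH False less_Suc_eq by (simp add: rS step_def) blast
        qed
      qed
    qed auto
    have sum_r: "f = r n + (\<Sum>i<n. fps_const (step i (r i)) * m (u i))" for n
      by (induction n) (auto simp: r0 rS)
    have inj: "inj_on u (vals A)"
      by (rule inj_onI) (metis u)
    \<comment> \<open>The expansion is indexed by orders, the required family by exponent functions.
      Distinct orders have distinct monomials, so \<open>u\<close> can be inverted on its image; all
      other monomials get coefficient 0.\<close>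
    define a where "a = (\<lambda>w. if w \<in> u ` vals A then step (the_inv_into (vals A) u w)
        (r (the_inv_into (vals A) u w)) else 0)"
    have a_u: "a (u n) = step n (r n)" if "n \<in> vals A" for n
      using that by (simp add: a_def the_inv_into_f_f[OF inj])
    have "((\<lambda>w. fps_const (a w) * m w) has_sum f) U"
      unfolding has_sum_def
    proof (rule tendsto_fpsI)
      fix n
      \<comment> \<open>Chosen monomials of order above \<open>n\<close> do not touch coefficient
        \<open>n\<close>, so every finite index set containing \<open>?F\<close> already gives the
        right value.\<close>
      let ?F = "u ` (vals A \<inter> {..n})"
      show "\<forall>\<^sub>F F in finite_subsets_at_top U. fps_nth (\<Sum>w\<in>F. fps_const (a w) * m w) n = fps_nth f n"
        unfolding eventually_finite_subsets_at_top
      proof (intro exI[of _ ?F] conjI allI impI)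
        show "finite ?F" by auto
        show "?F \<subseteq> U" using u by blast
        fix F assume F: "finite F \<and> ?F \<subseteq> F \<and> F \<subseteq> U"
        have "fps_nth (fps_const (a w) * m w) n = 0" if w: "w \<in> F - ?F" for w
        proof (cases "w \<in> u ` vals A")
          case True
          then obtain i where i: "i \<in> vals A" "w = u i" "i > n" using w by force
          then have "fps_nth (m w) n = 0" using u[OF i(1)] by (metis nth_less_subdegree_zero)
          then show ?thesis by simp
        qed (auto simp: a_def)
        then have "fps_nth (\<Sum>w\<in>F. fps_const (a w) * m w) n =
            fps_nth (\<Sum>w\<in>?F. fps_const (a w) * m w) n"
          unfolding fps_sum_nth using F by (intro sum.mono_neutral_right) auto
        also have "(\<Sum>w\<in>?F. fps_const (a w) * m w) =
            (\<Sum>i\<in>vals A \<inter> {..n}. fps_const (step i (r i)) * m (u i))"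
          by (subst sum.reindex) (auto intro: inj_on_subset[OF inj] sum.cong simp: a_u)
        also have "\<dots> = (\<Sum>i<Suc n. fps_const (step i (r i)) * m (u i))"
          by (intro sum.mono_neutral_left) (auto simp: step_def)
        also have "fps_nth \<dots> n = fps_nth f n"
        proof -
          have "fps_nth f n = fps_nth (r (Suc n)) n +
              fps_nth (\<Sum>i<Suc n. fps_const (step i (r i)) * m (u i)) n"
            using arg_cong[OF sum_r[of "Suc n"], of "\<lambda>h. fps_nth h n"] by (simp only: fps_add_nth)
          moreover have "fps_nth (r (Suc n)) n = 0"
            using rn[of "Suc n"] by blast
          ultimately show ?thesis by (simp only: add_0)
        qed
        finally show "fps_nth (\<Sum>w\<in>F. fps_const (a w) * m w) n = fps_nth f n" .
      qed
    qed
    then show "f \<in> power_series_in G" unfolding power_series_in_def m_def U_def by blast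
  qed
qed

section \<open>Trace ideals of subrings of a field\<close>

lemma ring_on_simps [simp]:
  "carrier (ring_on R) = R" "x \<otimes>\<^bsub>ring_on R\<^esub> y = x * y" "\<one>\<^bsub>ring_on R\<^esub> = 1"
  "x \<oplus>\<^bsub>ring_on R\<^esub> y = x + y" "\<zero>\<^bsub>ring_on R\<^esub> = 0"
  "x \<otimes>\<^bsub>ring_of_type_algebra\<^esub> y = x * y" "x \<oplus>\<^bsub>ring_of_type_algebra\<^esub> y = x + y"
  by (simp_all add: ring_of_type_algebra_def)

lemma ring_on_a_inv:
  assumes "cring (ring_on R)" "x \<in> R"
  shows "\<ominus>\<^bsub>ring_on R\<^esub> x = - x"
proof -
  interpret cring "ring_on R" by fact
  have "x + (\<ominus>\<^bsub>ring_on R\<^esub> x) = 0"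
    using r_neg[of x] assms(2) by simp
  then show ?thesis by (simp add: eq_neg_iff_add_eq_0 add.commute)
qed

lemma ring_on_minus:
  assumes "cring (ring_on R)" "x \<in> R" "y \<in> R"
  shows "x \<ominus>\<^bsub>ring_on R\<^esub> y = x - y"
  using assms by (simp add: a_minus_def ring_on_a_inv)

lemma ring_on_closed:
  fixes R :: "'a::field set"
  assumes "cring (ring_on R)"
  shows "0 \<in> R" "1 \<in> R" "x \<in> R \<Longrightarrow> y \<in> R \<Longrightarrow> x + y \<in> R" "x \<in> R \<Longrightarrow> y \<in> R \<Longrightarrow> x * y \<in> R"
    "x \<in> R \<Longrightarrow> - x \<in> R"
proof -
  interpret cring "ring_on R" by fact
  show "0 \<in> R" "1 \<in> R" "x \<in> R \<Longrightarrow> y \<in> R \<Longrightarrow> x + y \<in> R" "x \<in> R \<Longrightarrow> y \<in> R \<Longrightarrow> x * y \<in> R"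
    using zero_closed one_closed a_closed[of x y] m_closed[of x y] by simp_all
  show "x \<in> R \<Longrightarrow> - x \<in> R"
    using a_inv_closed[of x] ring_on_a_inv[OF assms, of x] by simp
qed

text \<open>Negation is covered by multiplication with the ring element -1.\<close>

lemma ideal_ring_on_iff:
  fixes R :: "'a::field set"
  assumes "cring (ring_on R)"
  shows "ideal I (ring_on R) \<longleftrightarrow>
    I \<subseteq> R \<and> 0 \<in> I \<and> (\<forall>x\<in>I. \<forall>y\<in>I. x + y \<in> I) \<and> (\<forall>a\<in>R. \<forall>x\<in>I. a * x \<in> I)"
    (is "?L \<longleftrightarrow> ?R")
proof
  interpret cring "ring_on R" by fact
  {
    assume ?L
    then interpret I: ideal I "ring_on R" .
    show ?R
      using I.a_subset I.zero_closed I.a_closed I.I_l_closed by simp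
  next
    assume r: ?R
    have "- x \<in> I" if "x \<in> I" for x
    proof -
      have "(- 1) * x \<in> I"
        using r that ring_on_closed[OF assms] by blast
      then show ?thesis by simp
    qed
    then have sub: "subgroup I (add_monoid (ring_on R))"
      using r ring_on_a_inv[OF assms]
      by (intro add.subgroupI) (auto simp: subset_iff a_inv_def)
    have comm: "x * a \<in> I" if "a \<in> R" "x \<in> I" for a x
    proof -
      have "a * x \<in> I" using r that by blast
      then show ?thesis by (subst mult.commute)
    qed
    show ?L
    proof (rule idealI[OF ring_axioms sub])
      fix a x assume "a \<in> I" "x \<in> carrier (ring_on R)"
      then have "a \<in> I" "x \<in> R" by simp_all
      then show "x \<otimes>\<^bsub>ring_on R\<^esub> a \<in> I" "a \<otimes>\<^bsub>ring_on R\<^esub> x \<in> I"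
        unfolding ring_on_simps using r comm by blast+
    qed
  }
qed

lemma finsum_ring_on:
  assumes "cring (ring_on R)" "\<And>i. i < (n::nat) \<Longrightarrow> f i \<in> R"
  shows "(\<Oplus>\<^bsub>ring_on R\<^esub>i\<in>{..<n}. f i) = (\<Sum>i<n. f i)"
proof -
  interpret cring "ring_on R" by fact
  show ?thesis
    using assms(2)
  proof (induction n)
    case (Suc n)
    have "(\<Oplus>\<^bsub>ring_on R\<^esub>i\<in>insert n {..<n}. f i) = f n + (\<Oplus>\<^bsub>ring_on R\<^esub>i\<in>{..<n}. f i)"
      by (subst finsum_insert) (use Suc.prems in auto)
    then show ?case
      using Suc by (simp add: lessThan_Suc add.commute)
  qed simp
qed

text \<open>An ideal regarded as a module over its ring; it serves as the module whose trace is the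
  given stable ideal.\<close>

definition ideal_module :: "'a::field set \<Rightarrow> ('a, 'a) module" where
  "ideal_module I = \<lparr>carrier = I, monoid.mult = (*), monoid.one = 1, ring.zero = 0,
      ring.add = (+), module.smult = (*)\<rparr>"

lemma ideal_module_simps [simp]:
  "carrier (ideal_module I) = I" "\<zero>\<^bsub>ideal_module I\<^esub> = 0"
  "x \<oplus>\<^bsub>ideal_module I\<^esub> y = x + y" "a \<odot>\<^bsub>ideal_module I\<^esub> x = a * x"
  by (simp_all add: ideal_module_def)

text \<open>A submodule of \<open>I\<close> is itself an ideal of the ring, so once it contains
  ideal generators of \<open>I\<close> it is all of \<open>I\<close>.\<close>

lemma finitely_generated_ideal_module:
  assumes noeth: "noetherian_ring (ring_on R)" and R: "cring (ring_on R)" and I: "ideal I (ring_on R)"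
  shows "finitely_generated_module (ring_on R) (ideal_module I)"
proof -
  note I' = I[unfolded ideal_ring_on_iff[OF R]]
  have neg: "- x \<in> I" if "x \<in> I" for x
  proof -
    have "(- 1) * x \<in> I"
      using I' that ring_on_closed[OF R] by blast
    then show ?thesis by simp
  qed
  have "abelian_group (ideal_module I)"
    by (rule abelian_groupI) (use I' neg in \<open>auto simp: add_ac intro: exI[of _ "- _"] bexI[of _ "- _"]\<close>)
  then have module: "Module.module (ring_on R) (ideal_module I)"
    by (intro moduleI R) (use I' in \<open>auto simp: subset_iff algebra_simps\<close>)
  obtain S where S: "finite S" "S \<subseteq> R" "I = genideal (ring_on R) S"
    using noetherian_ring.finetely_gen[OF noeth I] by auto
  have "N = I" if N: "submodule N (ring_on R) (ideal_module I)" "S \<subseteq> N" for N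
  proof
    interpret N: submodule N "ring_on R" "ideal_module I" by fact
    show sub: "N \<subseteq> I" using N.subset by simp
    have "ideal N (ring_on R)"
      unfolding ideal_ring_on_iff[OF R]
    proof (intro conjI ballI)
      show "N \<subseteq> R" using sub I' by (meson order_trans)
      show "0 \<in> N" using N.one_closed by simp
      show "x + y \<in> N" if "x \<in> N" "y \<in> N" for x y
        using N.m_closed[OF that] by simp
      show "a * x \<in> N" if "a \<in> R" "x \<in> N" for a x
        using N.smult_closed[of a x] that by simp
    qed
    then show "I \<subseteq> N"
      unfolding S(3) genideal_def using N(2) by blast
  qed
  moreover have "S \<subseteq> I"
    unfolding S(3) genideal_def by blast
  ultimately show ?thesis
    unfolding finitely_generated_module_def using module S(1) by auto
qed

text \<open>Multiplying linear forms by \<open>q\<close> shows that a trace ideal is stable; conversely, every linear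
  form on \<open>I\<close> is multiplication by some fraction \<open>q\<close>.\<close>

lemma regular_trace_ideals_ring_on:
  fixes R :: "'a::field set"
  assumes "noetherian_domain (ring_on R)"
  shows "regular_trace_ideals (ring_on R) =
    {I. ideal I (ring_on R) \<and> I \<noteq> {0} \<and> (\<forall>q. (\<forall>x\<in>I. q * x \<in> R) \<longrightarrow> (\<forall>x\<in>I. q * x \<in> I))}"
proof -
  interpret noetherian_domain "ring_on R" by fact
  have R: "cring (ring_on R)" by unfold_locales
  have noeth: "noetherian_ring (ring_on R)" by unfold_locales
  have regular: "regular_ideal I (ring_on R) \<longleftrightarrow> ideal I (ring_on R) \<and> I \<noteq> {0}" for I
  proof (cases "ideal I (ring_on R)")
    case True
    then have "0 \<in> I" by (simp add: ideal_ring_on_iff[OF R])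
    moreover have "(\<forall>y\<in>R. x * y = 0 \<longrightarrow> y = 0) \<longleftrightarrow> x \<noteq> 0" for x
      using ring_on_closed(2)[OF R] by (cases "x = 0") (auto intro: bexI[of _ 1])
    ultimately show ?thesis
      using True unfolding regular_ideal_def by auto
  qed (simp add: regular_ideal_def)
  have trace: "trace_ideal I (ring_on R) \<longleftrightarrow> (\<forall>q. (\<forall>x\<in>I. q * x \<in> R) \<longrightarrow> (\<forall>x\<in>I. q * x \<in> I))"
    if I: "ideal I (ring_on R)" "I \<noteq> {0}" for I
  proof
    have I': "I \<subseteq> R" "0 \<in> I" "\<And>x y. x \<in> I \<Longrightarrow> y \<in> I \<Longrightarrow> x + y \<in> I"
      using I(1) unfolding ideal_ring_on_iff[OF R] by blast+
    then have IR: "x \<in> R" if "x \<in> I" for x using that by blast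
    {
      assume "trace_ideal I (ring_on R)"
      then obtain M :: "('a, 'a) module" where M: "I = module_trace (ring_on R) M"
        unfolding trace_ideal_def by blast
      show "\<forall>q. (\<forall>x\<in>I. q * x \<in> R) \<longrightarrow> (\<forall>x\<in>I. q * x \<in> I)"
      proof (intro allI impI ballI)
        fix q x assume q: "\<forall>x\<in>I. q * x \<in> R" and x: "x \<in> I"
        obtain n \<phi> y where n: "x = (\<Oplus>\<^bsub>ring_on R\<^esub>i\<in>{..<n::nat}. \<phi> i (y i))"
          "\<And>i. i < n \<Longrightarrow> \<phi> i \<in> linear_forms (ring_on R) M \<and> y i \<in> carrier M"
          using x[unfolded M module_trace_def] by (auto simp del: ring_on_simps)
        \<comment> \<open>A single value is a sum with one term, so it lies in the trace and
          \<open>q\<close> maps it into \<open>R\<close>. This is what makes \<open>q\<close> times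
          a linear form a linear form again.\<close>
        have value_mem: "\<psi> z \<in> I" if "\<psi> \<in> linear_forms (ring_on R) M" "z \<in> carrier M" for \<psi> z
        proof -
          have z: "\<psi> z \<in> R" using that by (auto simp: linear_forms_def)
          have "\<psi> z = (\<Oplus>\<^bsub>ring_on R\<^esub>i\<in>{..<1::nat}. \<psi> z)"
            using z by (subst finsum_ring_on[OF R]) auto
          then show ?thesis
            unfolding M module_trace_def mem_Collect_eq using that
            by (intro exI[of _ 1] exI[of _ "\<lambda>_. \<psi>"] exI[of _ "\<lambda>_. z"]) simp
        qed
        have q\<phi>: "(\<lambda>z. q * \<phi> i z) \<in> linear_forms (ring_on R) M" if "i < n" for i
          using n(2)[OF that] q value_mem[of "\<phi> i"]
          by (auto simp: linear_forms_def algebra_simps)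
        have "q * x = (\<Sum>i<n. q * \<phi> i (y i))"
          unfolding n(1) using n(2) value_mem IR
          by (subst finsum_ring_on[OF R]) (auto simp: sum_distrib_left)
        also have "\<dots> = (\<Oplus>\<^bsub>ring_on R\<^esub>i\<in>{..<n}. q * \<phi> i (y i))"
          using n(2) value_mem q by (subst finsum_ring_on[OF R]) auto
        finally show "q * x \<in> I"
          using q\<phi> n(2) unfolding M module_trace_def mem_Collect_eq
          by (intro exI[of _ n] exI[of _ "\<lambda>i z. q * \<phi> i z"] exI[of _ y] conjI allI impI) simp_all
      qed
    next
      assume stable: "\<forall>q. (\<forall>x\<in>I. q * x \<in> R) \<longrightarrow> (\<forall>x\<in>I. q * x \<in> I)"
      obtain a where a: "a \<in> I" "a \<noteq> 0" using I(2) I'(2) by blast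
      have value_mem: "\<phi> x \<in> I"
        if \<phi>: "\<phi> \<in> linear_forms (ring_on R) (ideal_module I)" and x: "x \<in> I" for \<phi> x
      proof -
        \<comment> \<open>As \<open>a\<close> and \<open>y\<close> are ring elements, either factor
          can be pulled out of \<open>\<phi> (a * y)\<close>; comparing the results shows that
          \<open>\<phi>\<close> is multiplication by \<open>\<phi> a / a\<close>.\<close>
        have mult: "\<phi> y = (\<phi> a / a) * y" if "y \<in> I" for y
        proof -
          have "a \<in> R" "y \<in> R" using a that IR by auto
          then have "\<phi> (a * y) = a * \<phi> y" "\<phi> (y * a) = y * \<phi> a"
            using \<phi> that a by (auto simp: linear_forms_def)
          then show ?thesis using a(2) by (simp add: field_simps)
        qed
        have "\<phi> y \<in> R" if "y \<in> I" for y
          using \<phi> that by (auto simp: linear_forms_def)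
        then show ?thesis using stable mult x by metis
      qed
      have "module_trace (ring_on R) (ideal_module I) = I"
      proof
        show "module_trace (ring_on R) (ideal_module I) \<subseteq> I"
        proof
          fix s assume "s \<in> module_trace (ring_on R) (ideal_module I)"
          then obtain n \<phi> y where n: "s = (\<Oplus>\<^bsub>ring_on R\<^esub>i\<in>{..<n::nat}. \<phi> i (y i))"
            "\<And>i. i < n \<Longrightarrow> \<phi> i \<in> linear_forms (ring_on R) (ideal_module I) \<and> y i \<in> I"
            unfolding module_trace_def by auto
          then have mem: "\<phi> i (y i) \<in> I" if "i < n" for i
            using value_mem that by blast
          have "s = (\<Sum>i<n. \<phi> i (y i))"
            unfolding n(1) by (rule finsum_ring_on[OF R]) (use mem IR in blast)
          also have "\<dots> \<in> I"
            using mem by (induction n) (use I' in simp_all)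
          finally show "s \<in> I" .
        qed
        show "I \<subseteq> module_trace (ring_on R) (ideal_module I)"
        proof
          fix x assume x: "x \<in> I"
          have "x = (\<Oplus>\<^bsub>ring_on R\<^esub>i\<in>{..<1::nat}. x)"
            using x IR by (subst finsum_ring_on[OF R]) auto
          moreover have "(\<lambda>z. z) \<in> linear_forms (ring_on R) (ideal_module I)"
            using IR by (auto simp: linear_forms_def)
          ultimately show "x \<in> module_trace (ring_on R) (ideal_module I)"
            unfolding module_trace_def mem_Collect_eq using x
            by (intro exI[of _ 1] exI[of _ "\<lambda>_ z. z"] exI[of _ "\<lambda>_. x"]) simp
        qed
      qed
      then show "trace_ideal I (ring_on R)"
        unfolding trace_ideal_def
        by (intro exI[of _ "ideal_module I"] conjI finitely_generated_ideal_module[OF noeth R I(1)]) simp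
    }
  qed
  show ?thesis
    unfolding regular_trace_ideals_def regular
  proof (intro Collect_cong)
    fix I
    show "(ideal I (ring_on R) \<and> I \<noteq> {0}) \<and> trace_ideal I (ring_on R) \<longleftrightarrow>
      ideal I (ring_on R) \<and> I \<noteq> {0} \<and> (\<forall>q. (\<forall>x\<in>I. q * x \<in> R) \<longrightarrow> (\<forall>x\<in>I. q * x \<in> I))"
    proof (cases "ideal I (ring_on R) \<and> I \<noteq> {0}")
      case True
      then have "ideal I (ring_on R)" "I \<noteq> {0}" by simp_all
      from trace[OF this] True show ?thesis by argo
    qed argo
  qed
qed

section \<open>Subalgebras of the power series ring\<close>

lemma inj_fps_to_fls: "inj fps_to_fls"
  by (rule injI) simp

lemma fps_to_fls_subset_iff: "fps_to_fls ` S \<subseteq> fps_to_fls ` T \<longleftrightarrow> S \<subseteq> T"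
  using inj_image_subset_iff[OF inj_fps_to_fls] .

locale fps_subalgebra =
  fixes A :: "'k::field fps set"
  assumes const_mem: "fps_const a \<in> A"
    and add_mem: "f \<in> A \<Longrightarrow> g \<in> A \<Longrightarrow> f + g \<in> A"
    and mult_mem: "f \<in> A \<Longrightarrow> g \<in> A \<Longrightarrow> f * g \<in> A"
begin

abbreviation R :: "'k fls set" where
  "R \<equiv> fps_to_fls ` A"

text \<open>Ideals are described inside \<open>k[[t]]\<close>, where orders are available;
  \<open>ideal_image_iff\<close> carries them to \<open>ring_on R\<close>.\<close>

definition fps_ideal :: "'k fps set \<Rightarrow> bool" where
  "fps_ideal I \<longleftrightarrow> I \<subseteq> A \<and> 0 \<in> I \<and> (\<forall>f\<in>I. \<forall>g\<in>I. f + g \<in> I) \<and> (\<forall>a\<in>A. \<forall>f\<in>I. a * f \<in> I)"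

text \<open>The bound is put on coefficients because \<open>subdegree 0 = 0\<close>, so a bound on
  \<open>subdegree\<close> would lose the zero series.\<close>

definition order_ideal :: "nat \<Rightarrow> 'k fps set" where
  "order_ideal n = {f \<in> A. \<forall>i<n. fps_nth f i = 0}"

lemma zero_mem: "0 \<in> A" and one_mem: "1 \<in> A"
  using const_mem[of 0] const_mem[of 1] by simp_all

lemma subspace: "fps_subspace A"
  unfolding fps_subspace_def using zero_mem add_mem mult_mem const_mem by blast

lemma uminus_mem: "f \<in> A \<Longrightarrow> - f \<in> A"
  using mult_mem[OF const_mem[of "- 1"], of f] by (simp flip: fps_const_neg)

lemma fps_ideal_subspace: "fps_ideal I \<Longrightarrow> fps_subspace I"
  unfolding fps_subspace_def fps_ideal_def using const_mem by blast

lemma zero_mem_vals: "0 \<in> vals A"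
  using one_mem unfolding vals_def by force

lemma order_ideal_ideal: "fps_ideal (order_ideal n)"
proof -
  have "fps_nth (a * f) i = 0" if "\<forall>i<n. fps_nth f i = 0" "i < n" for a f :: "'k fps" and i
    unfolding fps_mult_nth using that by (intro sum.neutral) auto
  then show ?thesis
    unfolding fps_ideal_def order_ideal_def using zero_mem add_mem mult_mem by auto
qed

lemma vals_order_ideal: "vals (order_ideal n) = vals A \<inter> {n..}"
proof -
  have "(\<forall>i<n. fps_nth f i = 0) \<longleftrightarrow> n \<le> subdegree f" if "f \<noteq> 0" for f :: "'k fps"
    using that by (meson nth_less_subdegree_zero less_le_trans subdegree_geI)
  then have "order_ideal n - {0} = {f \<in> A - {0}. n \<le> subdegree f}"
    unfolding order_ideal_def by blast
  then show ?thesis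
    unfolding vals_def by auto
qed

lemma order_ideal_antimono: "m \<le> n \<Longrightarrow> order_ideal n \<subseteq> order_ideal m"
  unfolding order_ideal_def by auto

lemma cring_R: "cring (ring_on R)"
proof -
  have "\<exists>y\<in>R. y + x = 0" if "x \<in> R" for x
    using that uminus_mem by (intro bexI[of _ "- x"]) (auto simp flip: fps_to_fls_uminus)
  moreover have "x + y \<in> R" "x * y \<in> R" if "x \<in> R" "y \<in> R" for x y
    using that add_mem mult_mem
    by (auto simp flip: fps_to_fls_plus fls_times_fps_to_fls)
  moreover have "0 \<in> R" "1 \<in> R"
    using zero_mem one_mem by (auto intro: image_eqI[of _ _ 0] image_eqI[of _ _ 1])
  ultimately show ?thesis
    by (intro cringI abelian_groupI comm_monoidI) (simp_all add: algebra_simps)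
qed

lemma ideal_image_iff: "ideal (fps_to_fls ` I) (ring_on R) \<longleftrightarrow> fps_ideal I"
proof -
  have mem: "fps_to_fls f \<in> fps_to_fls ` S \<longleftrightarrow> f \<in> S" for f :: "'k fps" and S
    by auto
  have "0 \<in> fps_to_fls ` I \<longleftrightarrow> 0 \<in> I" using mem[of 0 I] by simp
  then show ?thesis
    unfolding ideal_ring_on_iff[OF cring_R] fps_ideal_def
    by (simp add: mem image_subset_iff subset_eq[of I A] flip: fps_to_fls_plus fls_times_fps_to_fls)
qed

lemma ideal_eq_image:
  assumes "ideal J (ring_on R)"
  obtains I where "J = fps_to_fls ` I" "fps_ideal I"
proof -
  have "J \<subseteq> R" using assms unfolding ideal_ring_on_iff[OF cring_R] by blast
  then obtain I where "J = fps_to_fls ` I" using subset_imageE by metis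
  then show ?thesis using that assms ideal_image_iff by blast
qed

text \<open>An ideal strictly above contains some \<open>f\<close> with nonzero constant term.
  Subtracting its part of positive order leaves a nonzero constant, which is a unit of
  \<open>A\<close>.\<close>

lemma maximalideal_order_ideal_1: "maximalideal (fps_to_fls ` order_ideal 1) (ring_on R)"
proof (rule maximalidealI)
  show "ideal (fps_to_fls ` order_ideal 1) (ring_on R)"
    unfolding ideal_image_iff by (rule order_ideal_ideal)
  have "1 \<notin> order_ideal 1" unfolding order_ideal_def by simp
  then show "carrier (ring_on R) \<noteq> fps_to_fls ` order_ideal 1"
    unfolding ring_on_simps inj_image_eq_iff[OF inj_fps_to_fls] using one_mem by blast
  fix J assume J: "ideal J (ring_on R)" "fps_to_fls ` order_ideal 1 \<subseteq> J"
  obtain K where K: "J = fps_to_fls ` K" "fps_ideal K" by (rule ideal_eq_image[OF J(1)])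
  have sub: "order_ideal 1 \<subseteq> K" using J(2) unfolding K(1) fps_to_fls_subset_iff .
  have K': "K \<subseteq> A" "\<And>f g. f \<in> K \<Longrightarrow> g \<in> K \<Longrightarrow> f + g \<in> K" "\<And>a f. a \<in> A \<Longrightarrow> f \<in> K \<Longrightarrow> a * f \<in> K"
    using K(2) unfolding fps_ideal_def by blast+
  have "K = order_ideal 1 \<or> K = A"
  proof (cases "K \<subseteq> order_ideal 1")
    case True
    then show ?thesis using sub by blast
  next
    case False
    then obtain f where f: "f \<in> K" "f \<notin> order_ideal 1" by blast
    then have fA: "f \<in> A" using K'(1) by blast
    then have c: "fps_nth f 0 \<noteq> 0" using f(2) unfolding order_ideal_def by simp
    have "fps_const (fps_nth f 0) - f \<in> A"
      using fps_subspace_diff[OF subspace const_mem fA, of _ 1] by simp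
    then have "fps_const (fps_nth f 0) - f \<in> order_ideal 1"
      unfolding order_ideal_def by simp
    then have "(fps_const (fps_nth f 0) - f) + f \<in> K" using K'(2) sub f(1) by blast
    then have "fps_const (fps_nth f 0) \<in> K" by simp
    from K'(3)[OF const_mem[of "inverse (fps_nth f 0)"] this] have "1 \<in> K"
      using c by simp
    then have "A \<subseteq> K" using K'(3)[of _ 1] by auto
    then show ?thesis using K'(1) by blast
  qed
  then show "J = fps_to_fls ` order_ideal 1 \<or> J = carrier (ring_on R)"
    unfolding K(1) ring_on_simps by blast
qed

lemma local_ring_maximal_ideal:
  assumes "local_ring (ring_on R) \<mm>"
  shows "\<mm> = fps_to_fls ` order_ideal 1"
  using assms maximalideal_order_ideal_1 unfolding local_ring_def by blast

section \<open>Powers of the maximal ideal\<close>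

lemma ideal_power_ideal: "ideal (ideal_power (ring_on R) (fps_to_fls ` order_ideal 1) n) (ring_on R)"
  and ideal_power_0: "ideal_power (ring_on R) (fps_to_fls ` order_ideal 1) 0 = R"
  and ideal_power_Suc: "ideal_power (ring_on R) (fps_to_fls ` order_ideal 1) (Suc n) =
    ideal_prod (ring_on R) (ideal_power (ring_on R) (fps_to_fls ` order_ideal 1) n) (fps_to_fls ` order_ideal 1)"
proof -
  let ?\<mm> = "fps_to_fls ` order_ideal 1"
  let ?I = "\<lambda>n. ideal_power (ring_on R) ?\<mm> n"
  interpret cring "ring_on R" by (rule cring_R)
  have I0: "?I 0 = R" and IS: "?I (Suc n) = ideal_prod (ring_on R) (?I n) ?\<mm>" for n
    by (simp_all add: nat_pow_def ideals_set_def)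
  show "?I 0 = R" "?I (Suc n) = ideal_prod (ring_on R) (?I n) ?\<mm>" by (fact I0 IS)+
  have \<mm>: "ideal ?\<mm> (ring_on R)" unfolding ideal_image_iff by (rule order_ideal_ideal)
  show "ideal (?I n) (ring_on R)"
  proof (induction n)
    case 0
    show ?case unfolding I0 using oneideal by simp
  next
    case (Suc n)
    show ?case unfolding IS using Suc \<mm> by (rule ideal_prod_is_ideal)
  qed
qed

text \<open>Orders add under multiplication. The case \<open>d = 1\<close> makes adic limits agree
  coefficientwise; \<open>d = min_order\<close> gives the sharp bound for the multiplicity.\<close>

lemma ideal_power_subset_order_ideal:
  assumes d: "order_ideal 1 \<subseteq> order_ideal d"
  shows "ideal_power (ring_on R) (fps_to_fls ` order_ideal 1) n \<subseteq> fps_to_fls ` order_ideal (d * n)"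
proof (induction n)
  case 0
  show ?case unfolding ideal_power_0 by (auto simp: order_ideal_def)
next
  case (Suc n)
  show ?case
    unfolding ideal_power_Suc
  proof
    let ?\<mm> = "fps_to_fls ` order_ideal 1"
    fix s assume "s \<in> ideal_prod (ring_on R) (ideal_power (ring_on R) ?\<mm> n) ?\<mm>"
    then show "s \<in> fps_to_fls ` order_ideal (d * Suc n)"
    proof (induction rule: ideal_prod.induct)
      case (prod i j)
      obtain f g where fg: "i = fps_to_fls f" "f \<in> order_ideal (d * n)"
        "j = fps_to_fls g" "g \<in> order_ideal d"
        using prod Suc.IH d by blast
      have "fps_nth (f * g) k = 0" if "k < d * Suc n" for k
      proof -
        \<comment> \<open>If \<open>i\<close> is at least \<open>d * n\<close>, then
          \<open>k - i\<close> is below \<open>d\<close>, so one of the two factors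
          vanishes.\<close>
        have "fps_nth f i * fps_nth g (k - i) = 0" if "i \<le> k" for i
          using fg \<open>k < d * Suc n\<close> that unfolding order_ideal_def
          by (cases "i < d * n") auto
        then show ?thesis unfolding fps_mult_nth by (intro sum.neutral) auto
      qed
      moreover have "f * g \<in> A" using fg mult_mem unfolding order_ideal_def by blast
      ultimately have "f * g \<in> order_ideal (d * Suc n)" unfolding order_ideal_def by blast
      then show ?case unfolding fg ring_on_simps by (metis fls_times_fps_to_fls imageI)
    next
      case (sum s1 s2)
      then show ?case
        using ideal_image_iff[of "order_ideal (d * Suc n)"] order_ideal_ideal
        unfolding ideal_ring_on_iff[OF cring_R] ring_on_simps by blast
    qed
  qed
qed

lemma power_mem_ideal_power:
  assumes x: "x \<in> order_ideal 1"
  shows "fps_to_fls (x ^ n) \<in> ideal_power (ring_on R) (fps_to_fls ` order_ideal 1) n"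
proof (induction n)
  case 0
  show ?case unfolding ideal_power_0 using one_mem by (metis imageI power_0)
next
  case (Suc n)
  have "fps_to_fls (x ^ n) \<otimes>\<^bsub>ring_on R\<^esub> fps_to_fls x \<in>
      ideal_power (ring_on R) (fps_to_fls ` order_ideal 1) (Suc n)"
    unfolding ideal_power_Suc using Suc.IH x by (intro ideal_prod.prod imageI)
  then show ?case by (simp add: fls_times_fps_to_fls mult.commute)
qed

end

section \<open>Subalgebras of finite codimension and their conductor exponent\<close>

locale cofinite_fps_subalgebra = fps_subalgebra A for A :: "'k::field fps set" +
  assumes ex_tail: "\<exists>N. \<forall>f. fps_X ^ N * f \<in> A"
begin

text \<open>The conductor of the semigroup of orders. That it is also the exponent of the conductor
  ideal rests on \<open>tail_mem\<close> and \<open>cond_exp_le_subdegree\<close>.\<close>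

definition cond_exp :: nat where
  "cond_exp = (LEAST n. {n..} \<subseteq> vals A)"

lemma ex_vals_tail: "\<exists>n. {n..} \<subseteq> vals A"
proof -
  obtain N where N: "\<And>f. fps_X ^ N * f \<in> A" using ex_tail by blast
  have "n \<in> vals A" if "n \<ge> N" for n
  proof -
    have "(fps_X ^ n :: 'k fps) \<in> A"
      using N[of "fps_X ^ (n - N)"] that by (simp flip: power_add)
    then show ?thesis
      unfolding vals_def by (intro image_eqI[of _ _ "fps_X ^ n"]) simp_all
  qed
  then show ?thesis by blast
qed

lemma ge_cond_exp_mem_vals: "n \<ge> cond_exp \<Longrightarrow> n \<in> vals A"
  using LeastI_ex[OF ex_vals_tail] unfolding cond_exp_def by auto

lemma cond_exp_le: "{n..} \<subseteq> vals A \<Longrightarrow> cond_exp \<le> n"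
  unfolding cond_exp_def by (rule Least_le)

lemma pred_cond_exp_notin_vals:
  assumes "cond_exp > 0"
  shows "cond_exp - 1 \<notin> vals A"
proof
  assume "cond_exp - 1 \<in> vals A"
  then have "{cond_exp - 1..} \<subseteq> vals A"
    using ge_cond_exp_mem_vals
    by (metis Suc_pred' assms atLeast_iff not_less_eq_eq order_antisym subsetI)
  from cond_exp_le[OF this] show False using assms by linarith
qed

text \<open>The exponent \<open>N\<close> known so far need not be optimal. Comparing
  \<open>A\<close> with the space of all series of order at least \<open>cond_exp\<close> shows that
  having all these orders forces having all these series.\<close>

lemma tail_mem: "fps_X ^ cond_exp * f \<in> A"
proof -
  obtain N where N: "\<And>f. fps_X ^ N * f \<in> A" using ex_tail by blast
  let ?J = "{f :: 'k fps. \<forall>i<cond_exp. fps_nth f i = 0}"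
  have J: "fps_subspace ?J"
    unfolding fps_subspace_def by auto
  have "?J \<subseteq> A"
  proof (rule fps_subspace_subset_by_vals[OF subspace J N])
    fix f :: "'k fps" assume f: "f \<in> ?J" "f \<noteq> 0"
    then have "cond_exp \<le> subdegree f"
      by (intro subdegree_geI) auto
    then obtain g where g: "g \<in> A" "g \<noteq> 0" "subdegree g = subdegree f"
      using ge_cond_exp_mem_vals[of "subdegree f"] unfolding vals_def by force
    moreover have "g \<in> ?J"
      using g(3) \<open>cond_exp \<le> subdegree f\<close> by (auto intro: nth_less_subdegree_zero)
    ultimately show "\<exists>g\<in>A \<inter> ?J. g \<noteq> 0 \<and> subdegree g = subdegree f" by blast
  qed
  moreover have "fps_X ^ cond_exp * f \<in> ?J"
    by (simp add: fps_X_power_mult_nth)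
  ultimately show ?thesis by blast
qed

lemma mem_if_coeffs_zero:
  assumes "\<And>i. i < cond_exp \<Longrightarrow> fps_nth f i = 0"
  shows "f \<in> A"
  using fps_eq_X_power_mult[OF assms] tail_mem by metis

text \<open>The products of \<open>y\<close> with powers of \<open>t\<close> realise every order
  from that of \<open>y\<close> on.\<close>

lemma cond_exp_le_subdegree:
  assumes "y \<noteq> 0" "\<And>f. y * f \<in> A"
  shows "cond_exp \<le> subdegree y"
proof (rule cond_exp_le, rule subsetI)
  fix n assume "n \<in> {subdegree y..}"
  then have "subdegree (y * fps_X ^ (n - subdegree y)) = n"
    using assms(1) by simp
  moreover have "y * fps_X ^ (n - subdegree y) \<noteq> 0"
    using assms(1) by simp
  ultimately have "y * fps_X ^ (n - subdegree y) \<in> A - {0}"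
      "n = subdegree (y * fps_X ^ (n - subdegree y))"
    using assms(2) by simp_all
  then show "n \<in> vals A"
    unfolding vals_def by (rule rev_image_eqI)
qed

lemma order_ideal_cond_exp: "order_ideal cond_exp = range ((*) (fps_X ^ cond_exp))"
proof
  show "order_ideal cond_exp \<subseteq> range ((*) (fps_X ^ cond_exp))"
    unfolding order_ideal_def using fps_eq_X_power_mult by blast
  show "range ((*) (fps_X ^ cond_exp)) \<subseteq> order_ideal cond_exp"
    unfolding order_ideal_def using tail_mem by (auto simp: fps_X_power_mult_nth)
qed

end

section \<open>Counting trace ideals\<close>

context cofinite_fps_subalgebra
begin

text \<open>The stability criterion of \<open>regular_trace_ideals_ring_on\<close>, transported to
  \<open>k[[t]]\<close>. A Laurent series \<open>q\<close> mapping a nonzero \<open>I\<close> into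
  \<open>R\<close> is a fraction of \<open>R\<close>, as \<open>q = (q x) / x\<close> for nonzero
  \<open>x\<close> in \<open>I\<close>.\<close>

definition trace_ideals :: "'k fps set set" where
  "trace_ideals = {I. fps_ideal I \<and> I \<noteq> {0} \<and>
     (\<forall>q. (\<forall>f\<in>I. q * fps_to_fls f \<in> R) \<longrightarrow> (\<forall>f\<in>I. q * fps_to_fls f \<in> fps_to_fls ` I))}"

lemma regular_trace_ideals_eq:
  assumes "noetherian_domain (ring_on R)"
  shows "regular_trace_ideals (ring_on R) = (`) fps_to_fls ` trace_ideals"
proof -
  let ?P = "\<lambda>J. ideal J (ring_on R) \<and> J \<noteq> {0} \<and> (\<forall>q. (\<forall>x\<in>J. q * x \<in> R) \<longrightarrow> (\<forall>x\<in>J. q * x \<in> J))"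
  have "fps_to_fls ` I \<noteq> {0} \<longleftrightarrow> I \<noteq> {0}" for I :: "'k fps set"
    using inj_image_eq_iff[OF inj_fps_to_fls, of I "{0}"] by simp
  then have P: "?P (fps_to_fls ` I) \<longleftrightarrow> I \<in> trace_ideals" for I
    unfolding trace_ideals_def ideal_image_iff by (simp only: mem_Collect_eq ball_simps)
  have "{J. ?P J} = (`) fps_to_fls ` trace_ideals"
  proof (intro subset_antisym subsetI)
    fix J assume "J \<in> {J. ?P J}"
    then have J: "?P J" by (rule CollectD)
    obtain I where I: "J = fps_to_fls ` I"
      by (rule ideal_eq_image[OF conjunct1[OF J]])
    have "I \<in> trace_ideals" using J unfolding I P .
    then show "J \<in> (`) fps_to_fls ` trace_ideals" unfolding I by (rule imageI)
  next
    fix J assume "J \<in> (`) fps_to_fls ` trace_ideals"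
    then obtain I where I: "J = fps_to_fls ` I" "I \<in> trace_ideals" by (rule imageE)
    have "?P J" using I(2) unfolding I(1) P .
    then show "J \<in> {J. ?P J}" by (rule CollectI)
  qed
  then show ?thesis
    unfolding regular_trace_ideals_ring_on[OF assms] .
qed

lemma card_regular_trace_ideals:
  assumes "noetherian_domain (ring_on R)"
  shows "card (regular_trace_ideals (ring_on R)) = card trace_ideals"
proof -
  have "inj_on ((`) fps_to_fls) trace_ideals"
    by (rule inj_onI) (simp add: inj_image_eq_iff[OF inj_fps_to_fls])
  then show ?thesis
    unfolding regular_trace_ideals_eq[OF assms] by (rule card_image)
qed

text \<open>A fraction multiplying an ideal that contains the conductor into \<open>R\<close> lies in \<open>k[[t]]\<close>, so it
  does not lower orders.\<close>

lemma order_ideal_trace: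
  assumes "n \<le> cond_exp"
  shows "order_ideal n \<in> trace_ideals"
proof -
  have tail: "fps_X ^ cond_exp * f \<in> order_ideal n" for f
    using order_ideal_antimono[OF assms] order_ideal_cond_exp by blast
  have "q * fps_to_fls f \<in> fps_to_fls ` order_ideal n"
    if q: "\<forall>f\<in>order_ideal n. q * fps_to_fls f \<in> R" and f: "f \<in> order_ideal n" for q f
  proof (cases "q = 0")
    case True
    then show ?thesis
      using order_ideal_ideal[of n] unfolding fps_ideal_def by (auto intro: image_eqI[of _ _ 0])
  next
    case False
    have qX: "q * fps_to_fls (fps_X ^ cond_exp * f) \<in> R" for f
      using q tail by blast
    \<comment> \<open>Here \<open>y = q t^c\<close> satisfies \<open>y k[[t]] \<subseteq> A\<close>,
      so its order is at least \<open>c\<close>; dividing by \<open>t^c\<close> shows that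
      \<open>q\<close> is a power series.\<close>
    then obtain y where y: "q * fps_to_fls (fps_X ^ cond_exp) = fps_to_fls y"
      using qX[of 1] by auto
    have yA: "y * f \<in> A" for f
    proof -
      have "fps_to_fls (y * f) = q * fps_to_fls (fps_X ^ cond_exp * f)"
        using y by (simp add: fls_times_fps_to_fls)
      then show ?thesis using qX[of f] by (metis fps_to_fls_eq_imp_fps_eq imageE)
    qed
    have "y \<noteq> 0"
      using y False by (metis fps_to_fls_eq_0_iff mult_eq_0_iff fps_X_neq_zero power_eq_0_iff)
    then have "cond_exp \<le> subdegree y" using yA by (rule cond_exp_le_subdegree)
    then have "y = fps_X ^ cond_exp * fps_shift cond_exp y"
      by (intro fps_eq_X_power_mult nth_less_subdegree_zero) simp
    then have "fps_to_fls (fps_X ^ cond_exp) * q =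
        fps_to_fls (fps_X ^ cond_exp) * fps_to_fls (fps_shift cond_exp y)"
      using y by (metis fls_times_fps_to_fls mult.commute)
    then have "q = fps_to_fls (fps_shift cond_exp y)"
      by (simp add: fps_X_neq_zero)
    then have qf: "q * fps_to_fls f = fps_to_fls (fps_shift cond_exp y * f)"
      by (simp add: fls_times_fps_to_fls)
    have "q * fps_to_fls f \<in> R" using q f by blast
    then have "fps_shift cond_exp y * f \<in> A"
      unfolding qf by auto
    moreover have "fps_nth (fps_shift cond_exp y * f) i = 0" if "i < n" for i
      unfolding fps_mult_nth using f that by (intro sum.neutral) (auto simp: order_ideal_def)
    ultimately show ?thesis
      unfolding qf order_ideal_def by blast
  qed
  moreover have "order_ideal n \<noteq> {0}"
    using tail[of 1] by (metis fps_X_neq_zero mult.right_neutral power_eq_0_iff singletonD)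
  ultimately show ?thesis
    unfolding trace_ideals_def using order_ideal_ideal[of n] by blast
qed

text \<open>Let \<open>a\<close> have least order in \<open>I\<close>, so that \<open>a\<close>
  divides all of \<open>I\<close> in \<open>k[[t]]\<close>. For \<open>y\<close> in the conductor
  the fraction \<open>y / a\<close> maps \<open>I\<close> into
  \<open>y k[[t]] \<subseteq> A\<close>, and stability applied to \<open>a\<close> puts
  \<open>y\<close> into \<open>I\<close>.\<close>

lemma cond_subset_trace_ideal:
  assumes "I \<in> trace_ideals"
  shows "order_ideal cond_exp \<subseteq> I"
proof -
  have I: "fps_ideal I" "I \<noteq> {0}" and
    stable: "\<And>q f. (\<And>f. f \<in> I \<Longrightarrow> q * fps_to_fls f \<in> R) \<Longrightarrow> f \<in> I \<Longrightarrow> q * fps_to_fls f \<in> fps_to_fls ` I"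
    using assms unfolding trace_ideals_def by blast+
  have "0 \<in> I" using I(1) unfolding fps_ideal_def by blast
  then have ne: "\<exists>f. f \<in> I \<and> f \<noteq> 0" using I(2) by blast
  define a where "a = (ARG_MIN subdegree f. f \<in> I \<and> f \<noteq> 0)"
  have a: "a \<in> I" "a \<noteq> 0" and a_min: "\<And>f. f \<in> I \<Longrightarrow> f \<noteq> 0 \<Longrightarrow> subdegree a \<le> subdegree f"
    using arg_min_natI[of "\<lambda>f. f \<in> I \<and> f \<noteq> 0"] ne
      arg_min_nat_le[of "\<lambda>f. f \<in> I \<and> f \<noteq> 0" _ subdegree] unfolding a_def by blast+
  have dvd: "a dvd f" if "f \<in> I" for f
    using a(2) a_min[OF that] by (cases "f = 0") (simp_all add: fps_dvd_iff)
  show ?thesis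
  proof
    fix y assume y: "y \<in> order_ideal cond_exp"
    then obtain z where z: "y = fps_X ^ cond_exp * z" unfolding order_ideal_cond_exp by blast
    let ?q = "fps_to_fls y / fps_to_fls a"
    have "?q * fps_to_fls f \<in> R" if f: "f \<in> I" for f
    proof -
      obtain w where "f = a * w" using dvd[OF f] by blast
      then have "?q * fps_to_fls f = fps_to_fls (fps_X ^ cond_exp * (z * w))"
        using a(2) unfolding z by (simp add: fls_times_fps_to_fls)
      then show ?thesis using tail_mem by blast
    qed
    from stable[OF this a(1)] have "fps_to_fls y \<in> fps_to_fls ` I"
      using a(2) by simp
    then show "y \<in> I" by auto
  qed
qed

text \<open>With \<open>i\<close> the least order of \<open>I\<close>, only an order strictly
  between \<open>i\<close> and \<open>cond_exp\<close> could be missing from \<open>I\<close>. If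
  \<open>i > 0\<close>, such an order together with 0 and \<open>i\<close> would make three; if
  \<open>i = 0\<close>, multiplying by an element of \<open>I\<close> of order 0 realises
  it.\<close>

lemma trace_ideal_eq_order_ideal:
  assumes "I \<in> trace_ideals" and card: "card (vals A \<inter> {..<cond_exp}) \<le> 2"
  shows "I \<in> order_ideal ` (vals A \<inter> {..cond_exp})"
proof -
  have I: "fps_ideal I" "I \<noteq> {0}"
    using assms unfolding trace_ideals_def by blast+
  have IA: "I \<subseteq> A" and I_mult: "\<And>a f. a \<in> A \<Longrightarrow> f \<in> I \<Longrightarrow> a * f \<in> I" and I0: "0 \<in> I"
    using I(1) unfolding fps_ideal_def by blast+
  note cond = cond_subset_trace_ideal[OF assms(1)]
  obtain f0 where f0: "f0 \<in> I" "f0 \<noteq> 0" using I(2) I0 by blast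
  define i where "i = (LEAST n. n \<in> vals I)"
  have "subdegree f0 \<in> vals I" using f0 unfolding vals_def by blast
  then have i: "i \<in> vals I" and i_le: "\<And>n. n \<in> vals I \<Longrightarrow> i \<le> n"
    unfolding i_def by (auto intro: LeastI Least_le)
  obtain g where g: "g \<in> I" "g \<noteq> 0" "subdegree g = i" using i unfolding vals_def by blast
  have sub: "I \<subseteq> order_ideal i"
  proof
    fix f assume f: "f \<in> I"
    have "fps_nth f j = 0" if "j < i" for j
    proof (cases "f = 0")
      case False
      then have "i \<le> subdegree f" using f i_le unfolding vals_def by blast
      then show ?thesis using that by (intro nth_less_subdegree_zero) simp
    qed simp
    then show "f \<in> order_ideal i" using f IA unfolding order_ideal_def by blast
  qed
  have iA: "i \<in> vals A" using i vals_mono[OF IA] by blast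
  show ?thesis
  proof (cases "cond_exp \<le> i")
    case True
    then have "I = order_ideal cond_exp"
      using sub order_ideal_antimono[OF True] cond by blast
    then show ?thesis using ge_cond_exp_mem_vals[of cond_exp] by blast
  next
    case False
    have "order_ideal i \<subseteq> I"
    proof (rule fps_subspace_subset_by_vals[OF fps_ideal_subspace fps_ideal_subspace])
      show "fps_ideal I" by fact
      show "fps_ideal (order_ideal i)" by (rule order_ideal_ideal)
      show "fps_X ^ cond_exp * f \<in> I" for f
        using cond unfolding order_ideal_cond_exp by blast
      fix f assume f: "f \<in> order_ideal i" "f \<noteq> 0"
      then have n: "subdegree f \<in> vals A" "i \<le> subdegree f"
        using vals_order_ideal[of i] unfolding vals_def by blast+
      have fA: "f \<in> A" using f(1) unfolding order_ideal_def by blast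
      consider "subdegree f \<ge> cond_exp" | "subdegree f = i" | "i < subdegree f" "subdegree f < cond_exp"
        using n(2) by linarith
      then have "\<exists>g\<in>I. g \<noteq> 0 \<and> subdegree g = subdegree f"
      proof cases
        case 1
        then have "f \<in> order_ideal cond_exp"
          using fA by (auto simp: order_ideal_def intro: nth_less_subdegree_zero)
        then show ?thesis using cond f(2) by blast
      next
        case 2
        then show ?thesis using g by metis
      next
        case 3
        have "i = 0"
        proof (rule ccontr)
          assume "i \<noteq> 0"
          then have "card {0, i, subdegree f} = 3" using 3 by simp
          moreover have "{0, i, subdegree f} \<subseteq> vals A \<inter> {..<cond_exp}"
            using 3 iA n(1) zero_mem_vals by auto
          then have "card {0, i, subdegree f} \<le> card (vals A \<inter> {..<cond_exp})"
            by (intro card_mono) simp_all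
          ultimately show False using card by linarith
        qed
        then have "subdegree (f * g) = subdegree f" "f * g \<noteq> 0"
          using f(2) g by simp_all
        then show ?thesis using I_mult[OF fA g(1)] by metis
      qed
      then show "\<exists>g\<in>I \<inter> order_ideal i. g \<noteq> 0 \<and> subdegree g = subdegree f"
        using sub by blast
    qed
    then have "I = order_ideal i" using sub by blast
    then show ?thesis using iA False by auto
  qed
qed

lemma inj_on_order_ideal: "inj_on order_ideal (vals A)"
proof (rule linorder_inj_onI')
  fix i j assume ij: "i \<in> vals A" "j \<in> vals A" "i < j"
  then have "i \<in> vals (order_ideal i)" "i \<notin> vals (order_ideal j)"
    unfolding vals_order_ideal by simp_all
  then show "order_ideal i \<noteq> order_ideal j" by metis
qed

text \<open>The additional order \<open>cond_exp\<close> stands for the conductor itself, which is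
  one of the trace ideals.\<close>

lemma card_vals_atMost:
  "card (vals A \<inter> {..cond_exp}) = Suc (card (vals A \<inter> {..<cond_exp}))"
proof -
  have "vals A \<inter> {..cond_exp} = insert cond_exp (vals A \<inter> {..<cond_exp})"
    using ge_cond_exp_mem_vals[of cond_exp] by auto
  then show ?thesis by simp
qed

text \<open>Up to two orders below \<open>cond_exp\<close> the order ideals are all the trace
  ideals; with more orders they already exceed the count \<open>Suc m\<close>.\<close>

lemma card_trace_ideals:
  assumes "m \<le> 2"
  shows "card trace_ideals = Suc m \<longleftrightarrow> card (vals A \<inter> {..<cond_exp}) = m"
proof -
  let ?W = "vals A \<inter> {..cond_exp}"
  have card_W: "card (order_ideal ` ?W) = Suc (card (vals A \<inter> {..<cond_exp}))"
    using card_vals_atMost by (subst card_image) (auto intro: inj_on_subset[OF inj_on_order_ideal])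
  have sub: "order_ideal ` ?W \<subseteq> trace_ideals"
    using order_ideal_trace by auto
  show ?thesis
  proof (cases "card (vals A \<inter> {..<cond_exp}) \<le> 2")
    case True
    then have "trace_ideals = order_ideal ` ?W"
      using sub trace_ideal_eq_order_ideal by blast
    then show ?thesis using card_W by simp
  next
    case False
    have "card trace_ideals \<noteq> Suc m"
    proof
      assume m: "card trace_ideals = Suc m"
      \<comment> \<open>The cardinality of an infinite set is 0, so a successor forces
        finiteness.\<close>
      then have "finite trace_ideals" using card.infinite by fastforce
      from card_mono[OF this sub] show False using card_W m False assms by linarith
    qed
    then show ?thesis using False assms by auto
  qed
qed

end

section \<open>Length\<close>

text \<open>Reading the decreasing sequence backwards and dropping repetitions gives an ascending
  chain with one step per jump. The last conjunct keeps the bottom above \<open>G M\<close>, so that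
  the next smaller member can be put in front.\<close>

lemma strict_chain_of_jumps:
  fixes G :: "nat \<Rightarrow> 'b set"
  assumes mono: "\<And>n. G (Suc n) \<subseteq> G n" and jump: "\<And>n. n \<in> D \<Longrightarrow> G (Suc n) \<noteq> G n"
  shows "\<exists>N. (\<forall>i. N i \<in> range G) \<and> (\<forall>i<card (D \<inter> {..<M}). N i \<subset> N (Suc i)) \<and> G M \<subseteq> N 0"
proof (induction M)
  case 0
  show ?case by (intro exI[of _ "\<lambda>_. G 0"]) auto
next
  case (Suc M)
  then obtain N where N: "\<And>i. N i \<in> range G" "\<And>i. i < card (D \<inter> {..<M}) \<Longrightarrow> N i \<subset> N (Suc i)"
    "G M \<subseteq> N 0" by blast
  show ?case
  proof (cases "M \<in> D")
    case True
    then have "D \<inter> {..<Suc M} = insert M (D \<inter> {..<M})" by auto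
    then have card: "card (D \<inter> {..<Suc M}) = Suc (card (D \<inter> {..<M}))" by simp
    have "G (Suc M) \<subset> N 0"
      using mono[of M] jump[OF True] N(3) by blast
    then show ?thesis
      unfolding card using N
      by (intro exI[of _ "case_nat (G (Suc M)) N"]) (auto split: nat.split)
  next
    case False
    then have "D \<inter> {..<Suc M} = D \<inter> {..<M}" by (auto simp: less_Suc_eq)
    then show ?thesis
      using N mono[of M] by (intro exI[of _ N]) auto
  qed
qed

lemma quotient_module_simps:
  "carrier (quotient_module R I) = (\<lambda>x. I +>\<^bsub>R\<^esub> x) ` carrier R"
  "\<zero>\<^bsub>quotient_module R I\<^esub> = I"
  "C \<oplus>\<^bsub>quotient_module R I\<^esub> C' = C <+>\<^bsub>R\<^esub> C'"
  "a \<odot>\<^bsub>quotient_module R I\<^esub> C = rcoset_mult R I (I +>\<^bsub>R\<^esub> a) C"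
  "inv\<^bsub>add_monoid (quotient_module R I)\<^esub> C = inv\<^bsub>add_monoid (R Quot I)\<^esub> C"
  by (auto simp: quotient_module_def FactRing_def A_RCOSETS_def' m_inv_def)

context cofinite_fps_subalgebra
begin

abbreviation fps_coset :: "'k fps set \<Rightarrow> 'k fps \<Rightarrow> 'k fls set" where
  "fps_coset I f \<equiv> fps_to_fls ` I +>\<^bsub>ring_on R\<^esub> fps_to_fls f"

abbreviation fps_quotient :: "'k fps set \<Rightarrow> ('k fls, 'k fls set) module" where
  "fps_quotient I \<equiv> quotient_module (ring_on R) (fps_to_fls ` I)"

context
  fixes I :: "'k fps set"
  assumes I: "fps_ideal I"
begin

interpretation J: ideal "fps_to_fls ` I" "ring_on R"
  using I ideal_image_iff by blast

lemma fps_coset_add: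
  "f \<in> A \<Longrightarrow> g \<in> A \<Longrightarrow> fps_coset I f <+>\<^bsub>ring_on R\<^esub> fps_coset I g = fps_coset I (f + g)"
  using J.a_rcos_sum[of "fps_to_fls f" "fps_to_fls g"] by simp

lemma fps_coset_smult:
  "f \<in> A \<Longrightarrow> g \<in> A \<Longrightarrow>
    rcoset_mult (ring_on R) (fps_to_fls ` I) (fps_coset I f) (fps_coset I g) = fps_coset I (f * g)"
  using J.rcoset_mult_add[of "fps_to_fls f" "fps_to_fls g"] by (simp add: fls_times_fps_to_fls)

lemma fps_coset_eq_ideal: "f \<in> I \<Longrightarrow> fps_coset I f = fps_to_fls ` I"
  by (rule J.a_rcos_const) simp

lemma fps_coset_eqD:
  assumes "f \<in> A" "fps_coset I f = fps_coset I g"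
  shows "\<exists>h\<in>I. f = h + g"
proof -
  have "fps_to_fls f \<in> fps_coset I g"
    using J.a_rcos_self[of "fps_to_fls f"] assms by simp
  then obtain h where "h \<in> I" "fps_to_fls f = fps_to_fls (h + g)"
    by (auto simp: a_r_coset_def')
  then show ?thesis using fps_to_fls_eq_imp_fps_eq by blast
qed

lemma submodule_of_ideal:
  assumes K: "fps_ideal K" and IK: "I \<subseteq> K"
  shows "submodule (fps_coset I ` K) (ring_on R) (fps_quotient I)"
proof -
  have KA: "K \<subseteq> A" and K0: "0 \<in> K" and K_add: "\<And>f g. f \<in> K \<Longrightarrow> g \<in> K \<Longrightarrow> f + g \<in> K"
    and K_mult: "\<And>a f. a \<in> A \<Longrightarrow> f \<in> K \<Longrightarrow> a * f \<in> K"
    using K unfolding fps_ideal_def by blast+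
  have I0: "0 \<in> I" using I unfolding fps_ideal_def by blast
  note zero = fps_coset_eq_ideal[OF I0]
  interpret Q: ring "ring_on R Quot (fps_to_fls ` I)" by (rule J.quotient_is_ring)
  show ?thesis
  proof (intro submodule.intro subgroup.intro submodule_axioms.intro)
    show "fps_coset I ` K \<subseteq> carrier (add_monoid (fps_quotient I))"
      using KA by (auto simp: quotient_module_simps)
    fix C C' assume "C \<in> fps_coset I ` K" "C' \<in> fps_coset I ` K"
    then obtain f g where fg: "C = fps_coset I f" "f \<in> K" "C' = fps_coset I g" "g \<in> K" by blast
    then have "f \<in> A" "g \<in> A" using KA by blast+
    then have "C \<oplus>\<^bsub>fps_quotient I\<^esub> C' = fps_coset I (f + g)"
      using fg by (simp only: quotient_module_simps fps_coset_add)
    then show "C \<otimes>\<^bsub>add_monoid (fps_quotient I)\<^esub> C' \<in> fps_coset I ` K"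
      using K_add[OF fg(2,4)] by (simp del: fps_to_fls_plus)
  next
    show "\<one>\<^bsub>add_monoid (fps_quotient I)\<^esub> \<in> fps_coset I ` K"
      using imageI[OF K0, of "fps_coset I"] unfolding zero by (simp add: quotient_module_simps)
  next
    fix C assume "C \<in> fps_coset I ` K"
    then obtain f where f: "C = fps_coset I f" "f \<in> K" by blast
    then have fA: "f \<in> A" using KA by blast
    have nK: "- f \<in> K"
      using K_mult[OF const_mem[of "- 1"] f(2)] by (simp flip: fps_const_neg)
    have "inv\<^bsub>add_monoid (fps_quotient I)\<^esub> C = fps_coset I (- f)"
      unfolding quotient_module_simps(5)
    proof (rule group.inv_equality[OF Q.a_group])
      have "fps_coset I (- f) <+>\<^bsub>ring_on R\<^esub> fps_coset I f = fps_coset I (- f + f)"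
        using nK KA fA by (intro fps_coset_add) blast+
      also have "\<dots> = fps_to_fls ` I" using zero by simp
      finally show "fps_coset I (- f) \<otimes>\<^bsub>add_monoid (ring_on R Quot fps_to_fls ` I)\<^esub> C =
          \<one>\<^bsub>add_monoid (ring_on R Quot fps_to_fls ` I)\<^esub>"
        unfolding f(1) by (simp add: FactRing_def)
    qed (use f fA uminus_mem[OF fA] in \<open>auto simp: FactRing_def A_RCOSETS_def' simp del: fps_to_fls_uminus\<close>)
    then show "inv\<^bsub>add_monoid (fps_quotient I)\<^esub> C \<in> fps_coset I ` K" 
      using imageI[OF nK, of "fps_coset I"] by (simp only:)
  next
    fix a C assume "a \<in> carrier (ring_on R)" "C \<in> fps_coset I ` K"
    then obtain b f where bf: "a = fps_to_fls b" "b \<in> A" "C = fps_coset I f" "f \<in> K" by auto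
    then have "f \<in> A" using KA by blast
    then have "a \<odot>\<^bsub>fps_quotient I\<^esub> C = fps_coset I (b * f)"
      unfolding bf(1,3) quotient_module_simps using bf(2) by (intro fps_coset_smult)
    then show "a \<odot>\<^bsub>fps_quotient I\<^esub> C \<in> fps_coset I ` K"
      using imageI[OF K_mult[OF bf(2,4)], of "fps_coset I"] by (simp only:)
  qed
qed

text \<open>Pulling a submodule of the quotient back to \<open>A\<close> gives a subspace between
  \<open>I\<close> and \<open>A\<close>, the form in which orders can be compared.\<close>

lemma subspace_of_submodule:
  assumes "submodule N (ring_on R) (fps_quotient I)"
  defines "S \<equiv> {f \<in> A. fps_coset I f \<in> N}"
  shows "fps_subspace S" "I \<subseteq> S" "N = fps_coset I ` S"
proof -
  interpret N: submodule N "ring_on R" "fps_quotient I" by fact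
  have I0: "0 \<in> I" and IA: "I \<subseteq> A" using I unfolding fps_ideal_def by blast+
  have zero: "fps_to_fls ` I \<in> N"
    using N.one_closed by (simp add: quotient_module_simps)
  then show "I \<subseteq> S"
    using fps_coset_eq_ideal IA unfolding S_def by auto
  have add: "f + g \<in> S" if "f \<in> S" "g \<in> S" for f g
  proof -
    have fg: "f \<in> A" "g \<in> A" "fps_coset I f \<in> N" "fps_coset I g \<in> N" using that unfolding S_def by blast+
    have "fps_coset I f \<oplus>\<^bsub>fps_quotient I\<^esub> fps_coset I g \<in> N"
      using N.m_closed[OF fg(3,4)] by simp
    then show ?thesis
      unfolding quotient_module_simps fps_coset_add[OF fg(1,2)] S_def using fg add_mem by blast
  qed
  have smult: "fps_const c * f \<in> S" if "f \<in> S" for c f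
  proof -
    have f: "f \<in> A" "fps_coset I f \<in> N" using that unfolding S_def by blast+
    have "fps_to_fls (fps_const c) \<in> carrier (ring_on R)"
      unfolding ring_on_simps using const_mem by (rule imageI)
    from N.smult_closed[OF this f(2)] show ?thesis
      unfolding quotient_module_simps fps_coset_smult[OF const_mem f(1)] S_def
      using f mult_mem const_mem by blast
  qed
  show "fps_subspace S"
    unfolding fps_subspace_def using add smult I0 \<open>I \<subseteq> S\<close> by blast
  have "N \<subseteq> fps_coset I ` A"
    using N.subset by (auto simp: quotient_module_simps)
  then show "N = fps_coset I ` S"
    unfolding S_def by blast
qed

text \<open>In any chain of submodules each strict step adds an order outside \<open>vals I\<close>,
  which bounds the length. The bound is attained by filtering the quotient by order.\<close>

lemma module_length_fps_quotient:
  assumes M: "\<And>f. fps_X ^ M * f \<in> I"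
  shows "module_length (ring_on R) (fps_quotient I) = enat (card (vals A - vals I))"
proof (rule antisym)
  have IA: "I \<subseteq> A" using I unfolding fps_ideal_def by blast
  have I_add: "\<And>f g. f \<in> I \<Longrightarrow> g \<in> I \<Longrightarrow> f + g \<in> I" and I0: "0 \<in> I"
    and I_mult: "\<And>a f. a \<in> A \<Longrightarrow> f \<in> I \<Longrightarrow> a * f \<in> I"
    using I unfolding fps_ideal_def by blast+
  have tail: "n \<in> vals I" if "n \<ge> M" for n
  proof -
    have "(fps_X ^ n :: 'k fps) \<in> I"
      using M[of "fps_X ^ (n - M)"] that by (simp flip: power_add)
    then have "fps_X ^ n \<in> I - {0}" "n = subdegree (fps_X ^ n :: 'k fps)" by simp_all
    then show ?thesis unfolding vals_def by (rule rev_image_eqI)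
  qed
  then have D: "vals A - vals I \<subseteq> {..<M}" by (meson DiffE lessThan_iff not_le subsetI)
  then have finD: "finite (vals A - vals I)" by (rule finite_subset) simp
  show "module_length (ring_on R) (fps_quotient I) \<le> enat (card (vals A - vals I))"
    unfolding module_length_def
  proof (rule SUP_least)
    fix n
    assume "n \<in> {n. \<exists>N. (\<forall>i\<le>n. submodule (N i) (ring_on R) (fps_quotient I)) \<and> (\<forall>i<n. N i \<subset> N (Suc i))}"
    then obtain N where N: "\<And>i. i \<le> n \<Longrightarrow> submodule (N i) (ring_on R) (fps_quotient I)"
      "\<And>i. i < n \<Longrightarrow> N i \<subset> N (Suc i)" by blast
    define S where "S = (\<lambda>i. {f \<in> A. fps_coset I f \<in> N i})"
    have S: "fps_subspace (S i)" "I \<subseteq> S i" "N i = fps_coset I ` S i" if "i \<le> n" for i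
      unfolding S_def using subspace_of_submodule[OF N(1)[OF that]] by simp_all
    have step: "vals (S i) \<subset> vals (S (Suc i))" if "i < n" for i
    proof (rule fps_subspace_psubset_vals)
      show "fps_subspace (S i)" "fps_subspace (S (Suc i))" using S(1) that by simp_all
      show "fps_X ^ M * f \<in> S i" for f using S(2)[of i] M that by auto
      have "S i \<subseteq> S (Suc i)" using N(2)[OF that] unfolding S_def by blast
      moreover have "S i \<noteq> S (Suc i)" using S(3)[of i] S(3)[of "Suc i"] N(2)[OF that] that by auto
      ultimately show "S i \<subset> S (Suc i)" by blast
    qed
    have "i \<le> card (vals (S i) - vals I)" if "i \<le> n" for i
      using that
    proof (induction i)
      case (Suc i)
      have "vals (S (Suc i)) - vals I \<subseteq> vals A - vals I"
        unfolding S_def by (intro Diff_mono vals_mono) auto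
      then have fin: "finite (vals (S (Suc i)) - vals I)" using finD by (rule finite_subset)
      have "vals I \<subseteq> vals (S i)" using S(2)[of i] Suc.prems by (intro vals_mono) simp
      then have "vals (S i) - vals I \<subset> vals (S (Suc i)) - vals I"
        using step[of i] Suc.prems by auto
      from psubset_card_mono[OF fin this] show ?case using Suc by linarith
    qed simp
    from this[of n] have "n \<le> card (vals (S n) - vals I)" by simp
    also have "\<dots> \<le> card (vals A - vals I)"
      unfolding S_def by (intro card_mono finD Diff_mono vals_mono) auto
    finally show "enat n \<le> enat (card (vals A - vals I))" by simp
  qed
  \<comment> \<open>\<open>K n\<close> is the sum of \<open>I\<close> and
    \<open>order_ideal n\<close>; its image in the quotient drops at each \<open>n\<close> that is
    an order of \<open>A\<close> but not of \<open>I\<close>.\<close>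
  define K where "K = (\<lambda>n. {f + g | f g. f \<in> I \<and> g \<in> order_ideal n})"
  have K_ideal: "fps_ideal (K n)" for n
  proof -
    have O: "order_ideal n \<subseteq> A" "0 \<in> order_ideal n"
      "\<And>f g. f \<in> order_ideal n \<Longrightarrow> g \<in> order_ideal n \<Longrightarrow> f + g \<in> order_ideal n"
      "\<And>a f. a \<in> A \<Longrightarrow> f \<in> order_ideal n \<Longrightarrow> a * f \<in> order_ideal n"
      using order_ideal_ideal[of n] unfolding fps_ideal_def by blast+
    show ?thesis
      unfolding fps_ideal_def
    proof (intro conjI ballI)
      show "K n \<subseteq> A" using IA O(1) add_mem unfolding K_def by blast
      have "0 = (0 :: 'k fps) + 0" by simp
      then show "0 \<in> K n" using I0 O(2) unfolding K_def by blast
      fix f g assume "f \<in> K n" "g \<in> K n"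
      then obtain f1 f2 g1 g2 where fg: "f = f1 + f2" "f1 \<in> I" "f2 \<in> order_ideal n"
        "g = g1 + g2" "g1 \<in> I" "g2 \<in> order_ideal n" unfolding K_def by blast
      then have "f + g = (f1 + g1) + (f2 + g2)" by simp
      then show "f + g \<in> K n" using I_add O(3) fg unfolding K_def by blast
    next
      fix a f assume a: "a \<in> A" "f \<in> K n"
      then obtain f1 f2 where fg: "f = f1 + f2" "f1 \<in> I" "f2 \<in> order_ideal n" unfolding K_def by blast
      then have "a * f = a * f1 + a * f2" by (simp add: distrib_left)
      then show "a * f \<in> K n" using I_mult O(4) a fg unfolding K_def by blast
    qed
  qed
  have IK: "I \<subseteq> K n" for n
    using order_ideal_ideal[of n] unfolding K_def fps_ideal_def by force
  let ?G = "\<lambda>n. fps_coset I ` K n"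
  have mono: "?G (Suc n) \<subseteq> ?G n" for n
    using order_ideal_antimono[of n "Suc n"] unfolding K_def by (intro image_mono) force
  \<comment> \<open>Without a drop, an element of \<open>A\<close> of order \<open>n\<close> would
    agree with an element of \<open>I\<close> up to terms of order above \<open>n\<close>, making
    \<open>n\<close> an order of \<open>I\<close>.\<close>
  have jump: "?G (Suc n) \<noteq> ?G n" if n: "n \<in> vals A - vals I" for n
  proof
    assume eq: "?G (Suc n) = ?G n"
    have "n \<in> vals (order_ideal n)" using n unfolding vals_order_ideal by simp
    then obtain f where f: "f \<in> order_ideal n" "f \<noteq> 0" "subdegree f = n" unfolding vals_def by force
    have "f = 0 + f" by simp
    then have "f \<in> K n" using I0 f(1) unfolding K_def by blast
    then have "fps_coset I f \<in> ?G (Suc n)" using eq by blast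
    then obtain g where g: "g \<in> K (Suc n)" "fps_coset I f = fps_coset I g" by blast
    have "f \<in> A" using f(1) unfolding order_ideal_def by blast
    then obtain h where h: "h \<in> I" "f = h + g" using fps_coset_eqD[OF _ g(2)] by blast
    obtain g1 g2 where g12: "g = g1 + g2" "g1 \<in> I" "g2 \<in> order_ideal (Suc n)"
      using g(1) unfolding K_def by blast
    have eq: "h + g1 = f - g2" using h(2) g12(1) by simp
    have g2: "\<forall>i\<le>n. fps_nth g2 i = 0" using g12(3) unfolding order_ideal_def by auto
    have "fps_nth f n \<noteq> 0" using f by auto
    then have ne: "fps_nth (h + g1) n \<noteq> 0" unfolding eq fps_sub_nth using g2 by simp
    moreover note ne
    moreover have "fps_nth (h + g1) i = 0" if "i < n" for i
    proof -
      have "fps_nth f i = 0" using that f(3) by (intro nth_less_subdegree_zero) blast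
      moreover have "fps_nth g2 i = 0" using g2 that less_imp_le by blast
      ultimately show ?thesis unfolding eq fps_sub_nth by (simp only: diff_0_right)
    qed
    ultimately have "subdegree (h + g1) = n" by (intro subdegreeI)
    moreover have "h + g1 \<noteq> 0" using ne by (metis fps_zero_nth)
    moreover have "h + g1 \<in> I" using I_add h(1) g12(2) by blast
    ultimately have "n \<in> vals I" unfolding vals_def by blast
    then show False using n by blast
  qed
  obtain N where N: "\<And>i. N i \<in> range ?G"
    "\<And>i. i < card ((vals A - vals I) \<inter> {..<M}) \<Longrightarrow> N i \<subset> N (Suc i)"
    using strict_chain_of_jumps[of ?G "vals A - vals I" M, OF mono jump] by blast
  have "(vals A - vals I) \<inter> {..<M} = vals A - vals I" using D by blast
  then have N_strict: "\<And>i. i < card (vals A - vals I) \<Longrightarrow> N i \<subset> N (Suc i)" using N(2) by simp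
  have N_sub: "submodule (N i) (ring_on R) (fps_quotient I)" for i
    using N(1)[of i] submodule_of_ideal[OF K_ideal IK] by fastforce
  show "enat (card (vals A - vals I)) \<le> module_length (ring_on R) (fps_quotient I)"
    unfolding module_length_def using N_strict N_sub by (intro SUP_upper CollectI exI[of _ N]) simp
qed

end

end

section \<open>Multiplicity\<close>

context cofinite_fps_subalgebra
begin

definition min_order :: nat where
  "min_order = (LEAST n. 0 < n \<and> n \<in> vals A)"

lemma min_order: "0 < min_order" "min_order \<in> vals A"
  and min_order_le: "0 < n \<Longrightarrow> n \<in> vals A \<Longrightarrow> min_order \<le> n"
proof -
  have "0 < Suc cond_exp \<and> Suc cond_exp \<in> vals A" using ge_cond_exp_mem_vals by simp
  from LeastI[of "\<lambda>n. 0 < n \<and> n \<in> vals A", OF this]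
  show "0 < min_order" "min_order \<in> vals A" unfolding min_order_def by blast+
  show "min_order \<le> n" if "0 < n" "n \<in> vals A"
    unfolding min_order_def using that by (intro Least_le) simp
qed

lemma order_ideal_1: "order_ideal 1 = order_ideal min_order"
proof
  show "order_ideal min_order \<subseteq> order_ideal 1"
    using min_order(1) by (intro order_ideal_antimono) simp
  show "order_ideal 1 \<subseteq> order_ideal min_order"
  proof
    fix f assume f: "f \<in> order_ideal 1"
    have "fps_nth f i = 0" if "i < min_order" for i
    proof (cases "f = 0")
      case False
      then have "subdegree f \<in> vals (order_ideal 1)" using f unfolding vals_def by blast
      then have "min_order \<le> subdegree f"
        unfolding vals_order_ideal using min_order_le[of "subdegree f"] by simp
      then show ?thesis using that by (intro nth_less_subdegree_zero) simp
    qed simp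
    then show "f \<in> order_ideal min_order" using f unfolding order_ideal_def by blast
  qed
qed

text \<open>If \<open>x\<close> has order \<open>e = min_order\<close>, then \<open>x^n\<close> is
  in the \<open>n\<close>-th power and \<open>x^n k[[t]] = t^(e n) k[[t]]\<close>. Multiplying by
  \<open>t^c k[[t]] \<subseteq> A\<close> gives the lower bound.\<close>

lemma ideal_power_sandwich:
  obtains P where "ideal_power (ring_on R) (fps_to_fls ` order_ideal 1) n = fps_to_fls ` P"
    "fps_ideal P" "P \<subseteq> order_ideal (min_order * n)" "\<And>f. fps_X ^ (cond_exp + min_order * n) * f \<in> P"
proof -
  obtain P where P: "ideal_power (ring_on R) (fps_to_fls ` order_ideal 1) n = fps_to_fls ` P" "fps_ideal P"
    by (rule ideal_eq_image[OF ideal_power_ideal])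
  have upper: "P \<subseteq> order_ideal (min_order * n)"
    using ideal_power_subset_order_ideal[OF equalityD1[OF order_ideal_1], of n]
    unfolding P(1) fps_to_fls_subset_iff .
  obtain x where x: "x \<in> A" "x \<noteq> 0" "subdegree x = min_order"
    using min_order(2) unfolding vals_def by force
  have "x \<in> order_ideal 1"
    using x min_order(1) unfolding order_ideal_def by (auto intro: nth_less_subdegree_zero)
  from power_mem_ideal_power[OF this, of n] have xn: "x ^ n \<in> P" unfolding P(1) by auto
  have "fps_X ^ (cond_exp + min_order * n) * f \<in> P" for f
  proof -
    have "x ^ n dvd fps_X ^ (min_order * n)"
      using x by (subst fps_dvd_iff) (simp_all add: subdegree_power mult.commute)
    then obtain w where w: "fps_X ^ (min_order * n) = x ^ n * w" by blast
    have "fps_X ^ (cond_exp + min_order * n) * f = (fps_X ^ cond_exp * (w * f)) * x ^ n"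
      unfolding power_add w by (simp only: mult_ac)
    then show ?thesis
      using P(2) xn tail_mem[of "w * f"] unfolding fps_ideal_def by metis
  qed
  then show ?thesis using that P upper by blast
qed

text \<open>By the sandwich the length at \<open>n\<close> differs from \<open>min_order * n\<close>
  by at most \<open>cond_exp\<close>, an error that vanishes after division by \<open>n\<close>;
  dimension 1 makes this the right normalisation.\<close>

lemma hilbert_samuel_multiplicity_eq:
  assumes "local_ring (ring_on R) \<mm>" and dim: "krull_dim (ring_on R) = 1"
  shows "hilbert_samuel_multiplicity (ring_on R) \<mm> = real min_order"
proof -
  let ?\<mm> = "fps_to_fls ` order_ideal 1"
  define l where "l = (\<lambda>n. real (the_enat (module_length (ring_on R)
    (quotient_module (ring_on R) (ideal_power (ring_on R) ?\<mm> n)))))"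
  have l: "real min_order * n - real cond_exp \<le> l n" "l n \<le> real min_order * n + real cond_exp" for n
  proof -
    obtain P where P: "ideal_power (ring_on R) ?\<mm> n = fps_to_fls ` P"
      "fps_ideal P" "P \<subseteq> order_ideal (min_order * n)" "\<And>f. fps_X ^ (cond_exp + min_order * n) * f \<in> P"
      using ideal_power_sandwich[of n] by blast
    have ln: "l n = real (card (vals A - vals P))"
      unfolding l_def P(1) module_length_fps_quotient[OF P(2,4)] by simp
    have "vals A - vals P \<subseteq> {..<cond_exp + min_order * n}"
    proof
      fix m assume m: "m \<in> vals A - vals P"
      show "m \<in> {..<cond_exp + min_order * n}"
      proof (rule ccontr)
        assume "m \<notin> {..<cond_exp + min_order * n}"
        then have "m = cond_exp + min_order * n + (m - (cond_exp + min_order * n))" by simp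
        then have "(fps_X ^ m :: 'k fps) \<in> P"
          using P(4)[of "fps_X ^ (m - (cond_exp + min_order * n))"] by (metis power_add)
        then have "fps_X ^ m \<in> P - {0}" "m = subdegree (fps_X ^ m :: 'k fps)" by simp_all
        then have "m \<in> vals P" unfolding vals_def by (rule rev_image_eqI)
        then show False using m by blast
      qed
    qed
    then have fin: "finite (vals A - vals P)"
      and "card (vals A - vals P) \<le> card {..<cond_exp + min_order * n}"
      by (rule finite_subset[OF _ finite_lessThan], rule card_mono[OF finite_lessThan])
    then have "real (card (vals A - vals P)) \<le> real (cond_exp + min_order * n)"
      by (simp only: of_nat_le_iff card_lessThan)
    then show "l n \<le> real min_order * n + real cond_exp" unfolding ln by simp
    \<comment> \<open>These orders occur in \<open>A\<close> but lie below every order of the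
      \<open>n\<close>-th power.\<close>
    have "{cond_exp..<min_order * n} \<subseteq> vals A - vals P"
      using ge_cond_exp_mem_vals vals_mono[OF P(3)] unfolding vals_order_ideal by auto
    from card_mono[OF fin this] have "min_order * n - cond_exp \<le> card (vals A - vals P)" by simp
    then have "min_order * n \<le> card (vals A - vals P) + cond_exp" by linarith
    then have "real (min_order * n) \<le> real (card (vals A - vals P) + cond_exp)"
      by (simp only: of_nat_le_iff)
    then show "real min_order * n - real cond_exp \<le> l n" unfolding ln by simp
  qed
  have lim0: "(\<lambda>n. real cond_exp / real n) \<longlonglongrightarrow> 0"
    by (rule lim_const_over_n)
  have "(\<lambda>n. l n / real n) \<longlonglongrightarrow> real min_order"
  proof (rule tendsto_sandwich)
    show "(\<lambda>n. real min_order - real cond_exp / real n) \<longlonglongrightarrow> real min_order"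
      using tendsto_diff[OF tendsto_const lim0, of "real min_order"] by simp
    show "(\<lambda>n. real min_order + real cond_exp / real n) \<longlonglongrightarrow> real min_order"
      using tendsto_add[OF tendsto_const lim0, of "real min_order"] by simp
    show "\<forall>\<^sub>F n in sequentially. real min_order - real cond_exp / real n \<le> l n / real n"
      using eventually_gt_at_top[of 0]
    proof eventually_elim
      case (elim n)
      have "real min_order - real cond_exp / real n = (real min_order * n - real cond_exp) / real n"
        using elim by (simp add: diff_divide_distrib)
      also have "\<dots> \<le> l n / real n" by (intro divide_right_mono l(1)) simp
      finally show ?case .
    qed
    show "\<forall>\<^sub>F n in sequentially. l n / real n \<le> real min_order + real cond_exp / real n"
      using eventually_gt_at_top[of 0]
    proof eventually_elim
      case (elim n)
      have "l n / real n \<le> (real min_order * n + real cond_exp) / real n"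
        by (intro divide_right_mono l(2)) simp
      also have "\<dots> = real min_order + real cond_exp / real n"
        using elim by (simp add: add_divide_distrib)
      finally show ?case .
    qed
  qed
  then have "lim (\<lambda>n. l n / real n) = real min_order" by (rule limI)
  then show ?thesis
    unfolding hilbert_samuel_multiplicity_def dim local_ring_maximal_ideal[OF assms(1)] l_def
    by (simp add: one_enat_def)
qed

end

section \<open>Complete rings\<close>

text \<open>Each \<open>r\<close> is a root of the monic polynomial \<open>X - r\<close>. Applied to
  the given ring, this places it inside \<open>k[[t]]\<close>.\<close>

lemma subset_integral_closure:
  assumes "cring (ring_on R)"
  shows "R \<subseteq> integral_closure (R :: 'a::field set)"
proof
  fix r assume r: "r \<in> R"
  note closed = ring_on_closed[OF assms]
  have "r = r / 1" by simp
  then have "r \<in> fractions R"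
    using r closed(2) one_neq_zero unfolding fractions_def by blast
  moreover have "integral_over R r"
    unfolding integral_over_def using r closed
    by (intro exI[of _ "[:- r, 1:]"]) (auto simp: coeff_pCons split: nat.split)
  ultimately show "r \<in> integral_closure R" unfolding integral_closure_def by blast
qed

text \<open>Since \<open>a\<close> is a unit times \<open>t^n\<close>, division by \<open>a\<close>
  leaves a polynomial remainder of degree below \<open>n\<close>; this is iterated. The exact error
  \<open>a^m r_m\<close> is recorded, so the expansion involves no limit.\<close>

lemma fps_adic_expansion:
  fixes a f :: "'k::field fps"
  assumes "a \<noteq> 0"
  obtains p r where "\<And>m i. i \<ge> subdegree a \<Longrightarrow> fps_nth (p m) i = 0"
    "\<And>m. f = (\<Sum>i<m. p i * a ^ i) + a ^ m * r m"
proof -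
  let ?n = "subdegree a"
  define u where "u = fps_shift ?n a"
  have ua: "a = fps_X ^ ?n * u"
    unfolding u_def by (intro fps_eq_X_power_mult nth_less_subdegree_zero)
  have "fps_nth u 0 \<noteq> 0"
    using assms unfolding u_def by simp
  then have inv: "u * inverse u = 1"
    by (rule inverse_mult_eq_1')
  define r where "r = rec_nat f (\<lambda>_ h. fps_shift ?n h * inverse u)"
  have r0: "r 0 = f" and rS: "r (Suc m) = fps_shift ?n (r m) * inverse u" for m
    by (simp_all add: r_def)
  define p where "p = (\<lambda>m. fps_cutoff ?n (r m))"
  have step: "r m = p m + a * r (Suc m)" for m
  proof -
    have "a * r (Suc m) = (fps_X ^ ?n * u) * (fps_shift ?n (r m) * inverse u)"
      unfolding rS by (simp only: ua[symmetric])
    also have "\<dots> = fps_X ^ ?n * fps_shift ?n (r m) * (u * inverse u)"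
      by (simp only: mult_ac)
    finally have "a * r (Suc m) = fps_X ^ ?n * fps_shift ?n (r m)"
      unfolding inv mult_1_right .
    moreover have "fps_X ^ ?n * fps_shift ?n (r m) + p m = r m"
      unfolding p_def by (rule fps_shift_cutoff')
    ultimately show ?thesis by (simp only: add.commute)
  qed
  have "f = (\<Sum>i<m. p i * a ^ i) + a ^ m * r m" for m
  proof (induction m)
    case (Suc m)
    have "a ^ m * r m = p m * a ^ m + a ^ Suc m * r (Suc m)"
      by (subst step[of m]) (simp only: distrib_left power_Suc mult_ac)
    then show ?case using Suc by (simp only: sum.lessThan_Suc add.assoc)
  qed (simp add: r0)
  moreover have "fps_nth (p m) i = 0" if "i \<ge> ?n" for m i
    using that by (simp add: p_def)
  ultimately show ?thesis using that by blast
qed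

context fps_subalgebra
begin

text \<open>If \<open>f = p\<^sub>0 + p\<^sub>1 a + p\<^sub>2 a^2 + \<dots>\<close> with \<open>deg p\<^sub>i < ord a\<close>, then the partial sums of
  \<open>b f\<close> form an adic Cauchy sequence in \<open>R\<close>, whose limit can only be \<open>b f\<close>.\<close>

lemma multiple_mem_if_complete:
  assumes complete: "adically_complete (ring_on R) (fps_to_fls ` order_ideal 1)"
    and a: "a \<in> order_ideal 1" "a \<noteq> 0"
    and b: "\<And>j. j < subdegree a \<Longrightarrow> b * fps_X ^ j \<in> A"
  shows "b * f \<in> A"
proof -
  let ?I = "ideal_power (ring_on R) (fps_to_fls ` order_ideal 1)"
  obtain p r where p: "\<And>m i. i \<ge> subdegree a \<Longrightarrow> fps_nth (p m) i = 0"
    and f: "\<And>m. f = (\<Sum>i<m. p i * a ^ i) + a ^ m * r m"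
    using fps_adic_expansion[OF a(2), of f] by blast
  have aA: "a ^ m \<in> A" for m
    using a(1) one_mem mult_mem unfolding order_ideal_def by (induction m) auto
  have sum_mem: "(\<Sum>i\<in>S. g i) \<in> A" if "\<And>i. i \<in> S \<Longrightarrow> g i \<in> A" for g and S :: "nat set"
    using that by (induction S rule: infinite_finite_induct) (auto intro: zero_mem add_mem)
  \<comment> \<open>Since \<open>p m\<close> has degree below the order of \<open>a\<close>, this
    product is a \<open>k\<close>-combination of the elements \<open>b t^j\<close> covered by the
    assumption on \<open>b\<close>.\<close>
  have bp: "b * p m \<in> A" for m
  proof -
    have "p m = (\<Sum>j<subdegree a. fps_const (fps_nth (p m) j) * fps_X ^ j)"
      using p[of _ m] by (intro fps_ext) (simp add: fps_sum_nth fps_X_power_nth if_distrib not_less cong: if_cong)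
    then have "b * p m = (\<Sum>j<subdegree a. fps_const (fps_nth (p m) j) * (b * fps_X ^ j))"
      by (metis (no_types, lifting) mult.left_commute sum.cong sum_distrib_left)
    also have "\<dots> \<in> A" using b mult_mem const_mem by (intro sum_mem) simp
    finally show ?thesis .
  qed
  define s where "s = (\<lambda>m. \<Sum>i<m. b * p i * a ^ i)"
  have sA: "s m \<in> A" for m
    unfolding s_def using bp aA mult_mem by (intro sum_mem) simp
  have in_power: "fps_to_fls (b * p m * a ^ m) \<in> ?I m" for m
  proof -
    have "fps_to_fls (b * p m) * fps_to_fls (a ^ m) \<in> ?I m"
      using ideal_power_ideal[of m] power_mem_ideal_power[OF a(1), of m] bp[of m]
      unfolding ideal_ring_on_iff[OF cring_R] by blast
    then show ?thesis by (simp only: fls_times_fps_to_fls)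
  qed
  have "fps_to_fls (s m) \<in> R \<and> fps_to_fls (s (Suc m)) \<ominus>\<^bsub>ring_on R\<^esub> fps_to_fls (s m) \<in> ?I m" for m
  proof -
    have "fps_to_fls (s (Suc m)) \<ominus>\<^bsub>ring_on R\<^esub> fps_to_fls (s m) = fps_to_fls (s (Suc m) - s m)"
      using sA by (subst ring_on_minus[OF cring_R]) simp_all
    also have "s (Suc m) - s m = b * p m * a ^ m" by (simp add: s_def)
    finally show ?thesis using in_power sA by simp
  qed
  then have "\<exists>y\<in>R. \<forall>m. y \<ominus>\<^bsub>ring_on R\<^esub> fps_to_fls (s m) \<in> ?I m"
    by (intro complete[unfolded adically_complete_def ring_on_simps, THEN conjunct2, THEN spec, THEN mp]) blast
  then obtain y where y: "y \<in> R" "\<And>m. y \<ominus>\<^bsub>ring_on R\<^esub> fps_to_fls (s m) \<in> ?I m"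
    by blast
  obtain Y where Y: "y = fps_to_fls Y" "Y \<in> A" using y(1) by blast
  have "fps_nth Y n = fps_nth (b * f) n" for n
  proof -
    \<comment> \<open>The limit differs from the partial sum \<open>s ?m\<close> by an element of
      order at least \<open>n + 1\<close>, and so does \<open>b * f\<close>; hence both have the
      same coefficient at \<open>n\<close>.\<close>
    let ?m = "Suc n"
    have "fps_to_fls (Y - s ?m) \<in> ?I ?m"
      using y(2)[of ?m] sA Y unfolding Y(1) by (subst (asm) ring_on_minus[OF cring_R]) simp_all
    then have "fps_to_fls (Y - s ?m) \<in> fps_to_fls ` order_ideal ?m"
      using ideal_power_subset_order_ideal[of 1 ?m] unfolding mult_1 by blast
    then have "Y - s ?m \<in> order_ideal ?m"
      unfolding inj_image_mem_iff[OF inj_fps_to_fls] .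
    then have "fps_nth (Y - s ?m) n = 0" unfolding order_ideal_def by simp
    then have "fps_nth Y n = fps_nth (s ?m) n" by simp
    moreover have "b * f = s ?m + a ^ ?m * (b * r ?m)"
      unfolding s_def by (subst f[of ?m]) (simp add: sum_distrib_left algebra_simps)
    moreover have "fps_nth (a ^ ?m * (b * r ?m)) n = 0"
    proof -
      have "fps_nth a 0 = 0" using a(1) unfolding order_ideal_def by simp
      then have "fps_nth (a ^ ?m) i = 0" if "i < ?m" for i
        using that by (rule startsby_zero_power_prefix[rule_format])
      then show ?thesis unfolding fps_mult_nth by (intro sum.neutral) auto
    qed
    ultimately show ?thesis by simp
  qed
  then have "Y = b * f" by (rule fps_ext)
  then show ?thesis using Y(2) by simp
qed

end

text \<open>As \<open>t\<close> is a fraction \<open>a / b\<close> of elements of \<open>A\<close>,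
  the element \<open>a = t b\<close> has positive order. Completeness turns a common denominator of
  finitely many powers of \<open>t\<close> into one for all of \<open>k[[t]]\<close>, and the
  multiples of that denominator contain a full tail.\<close>

lemma cofinite_fps_subalgebra_if_complete:
  fixes R :: "'k::field fls set"
  assumes R: "cring (ring_on R)" and loc: "local_ring (ring_on R) \<mm>"
    and complete: "adically_complete (ring_on R) \<mm>"
    and const: "range fls_const \<subseteq> R" and closure: "integral_closure R = range fps_to_fls"
  obtains A where "R = fps_to_fls ` A" "cofinite_fps_subalgebra A"
proof -
  define A where "A = {f. fps_to_fls f \<in> R}"
  have RA: "R = fps_to_fls ` A"
  proof
    show "R \<subseteq> fps_to_fls ` A"
      using subset_integral_closure[OF R] unfolding closure A_def by auto
    show "fps_to_fls ` A \<subseteq> R" unfolding A_def by auto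
  qed
  interpret fps_subalgebra A
    by unfold_locales
      (use const ring_on_closed[OF R] in \<open>auto simp: A_def fls_times_fps_to_fls\<close>)
  have \<mm>: "\<mm> = fps_to_fls ` order_ideal 1"
    using loc unfolding RA by (rule local_ring_maximal_ideal)
  have "fps_to_fls fps_X \<in> fractions R"
    using closure unfolding integral_closure_def by blast
  then obtain a b where ab: "a \<in> A" "b \<in> A" "b \<noteq> 0" "fps_to_fls fps_X = fps_to_fls a / fps_to_fls b"
    unfolding fractions_def RA by auto
  then have "fps_to_fls a = fps_to_fls (fps_X * b)"
    by (simp add: fls_times_fps_to_fls field_simps)
  then have a: "a = fps_X * b" by (rule fps_to_fls_eq_imp_fps_eq)
  have a1: "a \<in> order_ideal 1" using ab(1) unfolding order_ideal_def a by simp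
  have a0: "a \<noteq> 0" using ab(3) unfolding a by simp
  have pow: "f ^ n \<in> A" if "f \<in> A" for f n
    using that by (induction n) (auto intro: one_mem mult_mem)
  \<comment> \<open>With \<open>n\<close> the order of \<open>a\<close>, the identity
    \<open>b^n t^j = b^(n-j) a^j\<close> shows that \<open>b^n\<close> is the common
    denominator.\<close>
  have "b ^ subdegree a * fps_X ^ j \<in> A" if "j < subdegree a" for j
  proof -
    have "b ^ subdegree a * fps_X ^ j = b ^ (subdegree a - j) * (b ^ j * fps_X ^ j)"
      using that by (simp flip: power_add mult.assoc)
    also have "b ^ j * fps_X ^ j = a ^ j" unfolding a by (simp add: power_mult_distrib mult.commute)
    finally show ?thesis using pow ab(1,2) mult_mem by simp
  qed
  from multiple_mem_if_complete[OF complete[unfolded RA \<mm>] a1 a0 this]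
  have B: "b ^ subdegree a * f \<in> A" for f .
  have "b ^ subdegree a dvd fps_X ^ subdegree (b ^ subdegree a)"
    using ab(3) by (subst fps_dvd_iff) simp_all
  then obtain w where w: "fps_X ^ subdegree (b ^ subdegree a) = b ^ subdegree a * w" by blast
  have "fps_X ^ subdegree (b ^ subdegree a) * f \<in> A" for f
    unfolding w mult.assoc by (rule B)
  then have "cofinite_fps_subalgebra A"
    by unfold_locales blast
  then show ?thesis using that RA by blast
qed

section \<open>Power series presentations\<close>

lemma monomial_orders_0: "0 \<in> monomial_orders G"
  unfolding monomial_orders_def mem_Collect_eq by (intro exI[of _ "\<lambda>_. 0"]) simp

lemma monomial_orders_add:
  assumes "m \<in> monomial_orders G" "n \<in> monomial_orders G"
  shows "m + n \<in> monomial_orders G"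
proof -
  obtain u v where u: "\<forall>g. g \<notin> G \<longrightarrow> u g = 0" "(\<Prod>g\<in>G. g ^ u g) \<noteq> 0" "subdegree (\<Prod>g\<in>G. g ^ u g) = m"
    and v: "\<forall>g. g \<notin> G \<longrightarrow> v g = 0" "(\<Prod>g\<in>G. g ^ v g) \<noteq> 0" "subdegree (\<Prod>g\<in>G. g ^ v g) = n"
    using assms unfolding monomial_orders_def by blast
  have "(\<Prod>g\<in>G. g ^ (u g + v g)) = (\<Prod>g\<in>G. g ^ u g) * (\<Prod>g\<in>G. g ^ v g)"
    by (simp only: power_add prod.distrib)
  moreover have "subdegree ((\<Prod>g\<in>G. g ^ u g) * (\<Prod>g\<in>G. g ^ v g)) = m + n"
    using subdegree_mult[OF u(2) v(2)] unfolding u(3) v(3) .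
  moreover have "(\<Prod>g\<in>G. g ^ u g) * (\<Prod>g\<in>G. g ^ v g) \<noteq> 0"
    using u(2) v(2) by (rule no_zero_divisors)
  moreover have "\<forall>g. g \<notin> G \<longrightarrow> u g + v g = 0"
    using u(1) v(1) by simp
  ultimately show ?thesis
    unfolding monomial_orders_def mem_Collect_eq
    by (intro exI[of _ "\<lambda>g. u g + v g"]) (simp only: simp_thms)
qed

lemma subdegree_mem_monomial_orders:
  assumes "finite G" "g \<in> G" "g \<noteq> 0"
  shows "subdegree g \<in> monomial_orders G"
proof -
  have "(\<Prod>h\<in>G. h ^ (if h = g then 1 else 0)) = (\<Prod>h\<in>G. if h = g then h else 1)"
    by (intro prod.cong) auto
  also have "\<dots> = g" using assms by simp
  finally show ?thesis
    unfolding monomial_orders_def mem_Collect_eq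
    using assms by (intro exI[of _ "\<lambda>h. if h = g then 1 else 0"]) simp
qed

text \<open>A run of \<open>e\<close> consecutive orders meets every residue class modulo
  \<open>e\<close>; adding multiples of \<open>e\<close> reaches everything above.\<close>

lemma monomial_orders_ge:
  assumes e: "0 < e" "e \<in> monomial_orders G" and window: "{c..<c + e} \<subseteq> monomial_orders G"
    and "n \<ge> c"
  shows "n \<in> monomial_orders G"
  using \<open>n \<ge> c\<close>
proof (induction n rule: less_induct)
  case (less n)
  show ?case
  proof (cases "n < c + e")
    case True
    then show ?thesis using window less.prems by auto
  next
    case False
    then have "(n - e) + e \<in> monomial_orders G"
      using e less.IH[of "n - e"] by (intro monomial_orders_add) auto
    then show ?thesis using False by simp
  qed
qed

text \<open>The ring \<open>k + t^e k[[t]]\<close>.\<close>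

definition series_above :: "nat \<Rightarrow> 'k::field fps set" where
  "series_above e = {f. \<forall>i. 0 < i \<and> i < e \<longrightarrow> fps_nth f i = 0}"

lemma power_series_in_powers:
  assumes "0 < e"
  shows "power_series_in {fps_X ^ i | i. i \<in> {e..2 * e - 1}} = (series_above e :: 'k::field fps set)"
proof (rule power_series_in_eqI)
  let ?B = "series_above e :: 'k fps set"
  let ?G = "{fps_X ^ i | i. i \<in> {e..2 * e - 1}} :: 'k fps set"
  have G: "?G = (\<lambda>i. fps_X ^ i) ` {e..2 * e - 1}" by blast
  show fin: "finite ?G" unfolding G by simp
  show "?G \<subseteq> ?B" unfolding series_above_def by (auto simp: fps_X_power_nth)
  show "fps_subspace ?B" unfolding fps_subspace_def series_above_def by auto
  show "1 \<in> ?B" unfolding series_above_def by simp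
  show "fps_X ^ e * f \<in> ?B" for f unfolding series_above_def by (simp add: fps_X_power_mult_nth)
  show "f * g \<in> ?B" if fg: "f \<in> ?B" "g \<in> ?B" for f g
    unfolding series_above_def mem_Collect_eq
  proof (intro allI impI)
    fix i assume i: "0 < i \<and> i < e"
    have "fps_nth f j * fps_nth g (i - j) = 0" if "j \<le> i" for j
      using fg i that unfolding series_above_def by (cases "j = 0") auto
    then show "fps_nth (f * g) i = 0" unfolding fps_mult_nth by (intro sum.neutral) auto
  qed
  have window: "i \<in> monomial_orders ?G" if "i \<in> {e..<e + e}" for i
  proof -
    have "fps_X ^ i \<in> ?G" using that by auto
    from subdegree_mem_monomial_orders[OF fin this] show ?thesis by simp
  qed
  show "vals ?B \<subseteq> monomial_orders ?G"
  proof
    fix n assume "n \<in> vals ?B"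
    then obtain f where f: "f \<in> ?B" "f \<noteq> 0" "n = subdegree f" unfolding vals_def by blast
    have "n = 0 \<or> n \<ge> e"
      using f nth_subdegree_nonzero[of f] unfolding series_above_def by force
    then show "n \<in> monomial_orders ?G"
    proof
      assume "n \<ge> e"
      show ?thesis
      proof (rule monomial_orders_ge[OF assms _ _ \<open>n \<ge> e\<close>])
        show "e \<in> monomial_orders ?G" using assms by (intro window) simp
        show "{e..<e + e} \<subseteq> monomial_orders ?G" using window by blast
      qed
    qed (simp add: monomial_orders_0)
  qed
qed

text \<open>The space \<open>k + k x + t^c k[[t]]\<close>; it is closed under multiplication once
  \<open>x * x\<close> is a multiple of \<open>t^c\<close>.\<close>

definition two_step_series :: "'k::field fps \<Rightarrow> nat \<Rightarrow> 'k fps set" where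
  "two_step_series x c = {fps_const a + fps_const b * x + fps_X ^ c * h | a b h. True}"

lemma two_step_seriesI: "fps_const a + fps_const b * x + fps_X ^ c * h \<in> two_step_series x c"
  unfolding two_step_series_def by blast

lemma two_step_seriesE:
  assumes "f \<in> two_step_series x c"
  obtains a b h where "f = fps_const a + fps_const b * x + fps_X ^ c * h"
  using assms unfolding two_step_series_def by blast

lemma vals_two_step_series:
  assumes "x \<noteq> 0" "0 < subdegree x" "subdegree x < c"
  shows "vals (two_step_series x c) = {0, subdegree x} \<union> {c..}"
proof
  show "vals (two_step_series x c) \<subseteq> {0, subdegree x} \<union> {c..}"
  proof
    fix n assume "n \<in> vals (two_step_series x c)"
    then obtain f where f: "f \<in> two_step_series x c" "f \<noteq> 0" "n = subdegree f" unfolding vals_def by blast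
    obtain a b h where abh: "f = fps_const a + fps_const b * x + fps_X ^ c * h"
      using f(1) by (rule two_step_seriesE)
    have nth: "fps_nth f i = (if i = 0 then a else 0) + b * fps_nth x i + (if i < c then 0 else fps_nth h (i - c))" for i
      unfolding abh by (simp add: fps_X_power_mult_nth)
    have x: "fps_nth x i = 0" if "i < subdegree x" for i
      using that by (rule nth_less_subdegree_zero)
    have n: "fps_nth f n \<noteq> 0" unfolding f(3) using f(2) by simp
    have less: "fps_nth f i = 0" if "i < n" for i
      using that unfolding f(3) by (rule nth_less_subdegree_zero)
    show "n \<in> {0, subdegree x} \<union> {c..}"
    proof (rule ccontr)
      assume "n \<notin> {0, subdegree x} \<union> {c..}"
      then have n': "n \<noteq> 0" "n \<noteq> subdegree x" "n < c" by auto
      \<comment> \<open>Any other order would have to come from \<open>b * x\<close> beyond its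
        leading term, but then that leading term, at \<open>subdegree x < n\<close>, survives in
        \<open>f\<close>.\<close>
      have "b * fps_nth x n \<noteq> 0" using n nth[of n] n' by simp
      then have "b \<noteq> 0" "\<not> n < subdegree x" using x[of n] by auto
      then have "subdegree x < n" using n'(2) by linarith
      then have "fps_nth f (subdegree x) = 0" by (rule less)
      then have "b * fps_nth x (subdegree x) = 0" using nth[of "subdegree x"] assms by simp
      then show False using \<open>b \<noteq> 0\<close> assms(1) by simp
    qed
  qed
  have mem: "subdegree f \<in> vals (two_step_series x c)" if "f \<in> two_step_series x c" "f \<noteq> 0" for f
    using that unfolding vals_def by blast
  have "n \<in> vals (two_step_series x c)" if "n \<ge> c" for n
  proof -
    have eq: "(fps_X ^ n :: 'a fps) = fps_X ^ c * fps_X ^ (n - c)"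
      using that by (simp flip: power_add)
    have "fps_X ^ n \<in> two_step_series x c"
      unfolding eq using two_step_seriesI[of 0 0 x c "fps_X ^ (n - c)"] by simp
    from mem[OF this] show ?thesis by simp
  qed
  moreover have "1 \<in> two_step_series x c" "x \<in> two_step_series x c"
    using two_step_seriesI[of 1 0 x c 0] two_step_seriesI[of 0 1 x c 0] by simp_all
  then have "subdegree x \<in> vals (two_step_series x c)" "0 \<in> vals (two_step_series x c)"
    using mem[of 1] mem[of x] assms(1) by simp_all
  ultimately show "{0, subdegree x} \<union> {c..} \<subseteq> vals (two_step_series x c)" by auto
qed

text \<open>The omitted \<open>t^(2e)\<close> is replaced by the square of
  \<open>\<alpha> t^e\<close>: it also has order \<open>2 e\<close>, so the generators still realise
  \<open>e\<close> consecutive orders from \<open>c\<close> on. The bound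
  \<open>c \<le> 2 * e\<close> is what closes the right side under products.\<close>

lemma power_series_in_two_step:
  fixes \<alpha> :: "'k::field fps"
  assumes \<alpha>: "\<alpha> dvd 1" and c: "e + 2 \<le> c" "c \<le> 2 * e"
  shows "power_series_in (insert (\<alpha> * fps_X ^ e) {fps_X ^ i | i. i \<in> {c..c + e - 1} - {2 * e}}) =
    two_step_series (\<alpha> * fps_X ^ e) c"
proof (rule power_series_in_eqI)
  let ?x = "\<alpha> * fps_X ^ e"
  let ?B = "two_step_series ?x c"
  let ?G = "insert ?x {fps_X ^ i | i. i \<in> {c..c + e - 1} - {2 * e}}"
  have "fps_nth \<alpha> 0 \<noteq> 0" using \<alpha> by (simp add: fps_is_unit_iff)
  then have \<alpha>0: "\<alpha> \<noteq> 0" "subdegree \<alpha> = 0" by (auto simp: subdegree_eq_0_iff)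
  have x: "?x \<noteq> 0" "subdegree ?x = e" using \<alpha>0 by simp_all
  have G: "?G = insert ?x ((\<lambda>i. fps_X ^ i) ` ({c..c + e - 1} - {2 * e}))" by blast
  show fin: "finite ?G" unfolding G by simp
  show B_tail: "fps_X ^ c * f \<in> ?B" for f using two_step_seriesI[of 0 0 ?x c f] by simp
  have "fps_X ^ i \<in> ?B" if "i \<ge> c" for i
  proof -
    have eq: "(fps_X ^ i :: 'k fps) = fps_X ^ c * fps_X ^ (i - c)"
      using that by (simp flip: power_add)
    show ?thesis unfolding eq by (rule B_tail)
  qed
  moreover have "?x \<in> ?B" using two_step_seriesI[of 0 1 ?x c 0] by simp
  ultimately show "?G \<subseteq> ?B" by auto
  show "1 \<in> ?B" using two_step_seriesI[of 1 0 ?x c 0] by simp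
  show "fps_subspace ?B"
    unfolding fps_subspace_def
  proof (intro conjI ballI allI)
    show "0 \<in> ?B" using two_step_seriesI[of 0 0 ?x c 0] by simp
    fix f g assume "f \<in> ?B" "g \<in> ?B"
    then obtain a b h a' b' h' where f: "f = fps_const a + fps_const b * ?x + fps_X ^ c * h"
      and g: "g = fps_const a' + fps_const b' * ?x + fps_X ^ c * h'" by (elim two_step_seriesE)
    have "f + g = fps_const (a + a') + fps_const (b + b') * ?x + fps_X ^ c * (h + h')"
      unfolding f g fps_const_add[symmetric] by (simp only: distrib_left distrib_right add_ac)
    then show "f + g \<in> ?B" by (simp only: two_step_seriesI)
  next
    fix d f assume "f \<in> ?B"
    then obtain a b h where f: "f = fps_const a + fps_const b * ?x + fps_X ^ c * h"
      by (elim two_step_seriesE)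
    have "fps_const d * f = fps_const (d * a) + fps_const (d * b) * ?x + fps_X ^ c * (fps_const d * h)"
      unfolding f fps_const_mult[symmetric] by (simp only: distrib_left mult_ac)
    then show "fps_const d * f \<in> ?B" by (simp only: two_step_seriesI)
  qed
  \<comment> \<open>The cofactor that exhibits the square of \<open>\<alpha> t^e\<close> as a
    multiple of \<open>t^c\<close>.\<close>
  define s where "s = fps_X ^ (2 * e - c) * \<alpha> ^ 2"
  have "c + (2 * e - c) = e + e" using c(2) by simp
  then have "fps_X ^ c * s = fps_X ^ (e + e) * \<alpha> ^ 2"
    unfolding s_def by (simp only: mult.assoc[symmetric] power_add[symmetric])
  then have xx: "?x * ?x = fps_X ^ c * s"
    by (simp only: power2_eq_square power_add mult_ac)
  show "f * g \<in> ?B" if fg: "f \<in> ?B" "g \<in> ?B" for f g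
  proof -
    obtain a b h a' b' h' where f: "f = fps_const a + fps_const b * ?x + fps_X ^ c * h"
      and g: "g = fps_const a' + fps_const b' * ?x + fps_X ^ c * h'"
      using fg by (elim two_step_seriesE)
    have expand: "(p + q * y + z * h) * (p' + q' * y + z * h') = p * p' + (p * q' + q * p') * y +
        z * (q * q' * s + p * h' + q * y * h' + h * p' + h * q' * y + z * h * h')"
      if yy: "y * y = z * s" for p q p' q' y z :: "'k fps"
    proof -
      have "(p + q * y + z * h) * (p' + q' * y + z * h') = p * p' + (p * q' + q * p') * y +
          q * q' * (y * y) + z * (p * h' + q * y * h' + h * p' + h * q' * y + z * h * h')"
        by (simp only: distrib_left distrib_right mult_ac add_ac)
      then show ?thesis
        unfolding yy by (simp only: distrib_left distrib_right mult_ac add_ac)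
    qed
    show ?thesis
      unfolding f g expand[OF xx] fps_const_mult fps_const_add by (rule two_step_seriesI)
  qed
  have e: "e \<in> monomial_orders ?G"
    using subdegree_mem_monomial_orders[OF fin, of ?x] x by simp
  have window: "i \<in> monomial_orders ?G" if i: "i \<in> {c..<c + e}" for i
  proof (cases "i = 2 * e")
    case True
    then show ?thesis using monomial_orders_add[OF e e] by (simp only: mult_2)
  next
    case False
    then have "fps_X ^ i \<in> ?G" using i by auto
    from subdegree_mem_monomial_orders[OF fin this] show ?thesis by simp
  qed
  have e0: "0 < e" using c by linarith
  have V: "vals ?B = {0, e} \<union> {c..}"
    using vals_two_step_series[of ?x c] x e0 c(1) by simp
  show "vals ?B \<subseteq> monomial_orders ?G"
  proof
    fix n assume "n \<in> vals ?B"
    then consider "n = 0" | "n = e" | "n \<ge> c" unfolding V by blast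
    then show "n \<in> monomial_orders ?G"
    proof cases
      case 3
      then show ?thesis using window by (intro monomial_orders_ge[OF e0 e]) blast+
    qed (simp_all only: monomial_orders_0 e)
  qed
qed

section \<open>The conductor, and the rings with one or two orders below it\<close>

context cofinite_fps_subalgebra
begin

lemma conductor_eq:
  assumes "integral_closure R = range fps_to_fls"
  shows "conductor R = fps_to_fls ` order_ideal cond_exp"
proof
  have R_fractions: "R \<subseteq> fractions R"
  proof
    fix r assume "r \<in> R"
    moreover have "1 \<in> R" using one_mem by (metis fps_one_to_fls imageI)
    moreover have "r = r / 1" by simp
    ultimately show "r \<in> fractions R" unfolding fractions_def by (metis (mono_tags, lifting) mem_Collect_eq one_neq_zero)
  qed
  show "fps_to_fls ` order_ideal cond_exp \<subseteq> conductor R"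
  proof
    fix a assume "a \<in> fps_to_fls ` order_ideal cond_exp"
    then obtain f where f: "a = fps_to_fls (fps_X ^ cond_exp * f)"
      unfolding order_ideal_cond_exp by blast
    have "a \<in> R" unfolding f using tail_mem by blast
    moreover have "a * fps_to_fls g \<in> R" for g
    proof -
      have "a * fps_to_fls g = fps_to_fls (fps_X ^ cond_exp * (f * g))"
        unfolding f by (simp only: fls_times_fps_to_fls mult.assoc)
      then show ?thesis using tail_mem by blast
    qed
    ultimately show "a \<in> conductor R"
      unfolding conductor_def assms using R_fractions by blast
  qed
  show "conductor R \<subseteq> fps_to_fls ` order_ideal cond_exp"
  proof
    fix a assume "a \<in> conductor R"
    then have a: "a * fps_to_fls g \<in> R" for g
      unfolding conductor_def assms by blast
    from a[of 1] obtain f where f: "a = fps_to_fls f" "f \<in> A" by auto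
    have fg: "f * g \<in> A" for g
      using a[of g] unfolding f(1) by (auto simp flip: fls_times_fps_to_fls)
    have "f \<in> order_ideal cond_exp"
    proof (cases "f = 0")
      case True
      then show ?thesis using f(2) by (simp add: order_ideal_def)
    next
      case False
      then have "cond_exp \<le> subdegree f" using fg by (rule cond_exp_le_subdegree)
      then have "fps_nth f i = 0" if "i < cond_exp" for i
        using that by (intro nth_less_subdegree_zero) linarith
      then show ?thesis using f(2) unfolding order_ideal_def by blast
    qed
    then show "a \<in> fps_to_fls ` order_ideal cond_exp" unfolding f(1) by (rule imageI)
  qed
qed

lemma module_length_conductor:
  assumes "integral_closure R = range fps_to_fls"
  shows "module_length (ring_on R) (quotient_module (ring_on R) (conductor R)) =
    enat (card (vals A \<inter> {..<cond_exp}))"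
proof -
  have "vals A - vals (order_ideal cond_exp) = vals A \<inter> {..<cond_exp}"
    unfolding vals_order_ideal by auto
  moreover have tail: "fps_X ^ cond_exp * f \<in> order_ideal cond_exp" for f
    unfolding order_ideal_cond_exp by blast
  ultimately show ?thesis
    unfolding conductor_eq[OF assms] module_length_fps_quotient[OF order_ideal_ideal tail] by (simp only:)
qed

lemma diff_const_mem: "f \<in> A \<Longrightarrow> f - fps_const a \<in> A"
  using fps_subspace_diff[OF subspace _ const_mem, of f 1 a] by simp

lemma sub_constant_coeff_mem_order_ideal:
  assumes "f \<in> A"
  shows "f - fps_const (fps_nth f 0) \<in> order_ideal min_order"
proof -
  have "f - fps_const (fps_nth f 0) \<in> order_ideal 1"
    unfolding order_ideal_def using diff_const_mem[OF assms] by simp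
  then show ?thesis unfolding order_ideal_1 .
qed

text \<open>If 0 is the only order below \<open>cond_exp\<close>, then
  \<open>min_order = cond_exp\<close> and constants together with the tail make up \<open>A\<close>.
  For \<open>A = k[[t]]\<close> the count is 0, which \<open>2 \<le> min_order\<close> rules
  out.\<close>

lemma card_vals_eq_1_iff:
  "card (vals A \<inter> {..<cond_exp}) = 1 \<longleftrightarrow> 2 \<le> min_order \<and> A = series_above min_order"
proof
  assume "card (vals A \<inter> {..<cond_exp}) = 1"
  then obtain x where x: "vals A \<inter> {..<cond_exp} = {x}" by (rule card_1_singletonE)
  then have "x < cond_exp" by blast
  then have "0 < cond_exp" by linarith
  then have "0 \<in> vals A \<inter> {..<cond_exp}" using zero_mem_vals by simp
  then have "x = 0" unfolding x by simp
  with x have V: "vals A \<inter> {..<cond_exp} = {0}" by (simp only:)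
  \<comment> \<open>The predecessor of \<open>cond_exp\<close> is a gap, whereas 0 is an
    order.\<close>
  have "cond_exp - 1 \<noteq> 0"
    using pred_cond_exp_notin_vals[OF \<open>0 < cond_exp\<close>] zero_mem_vals by metis
  then have c2: "2 \<le> cond_exp" by linarith
  have "min_order \<le> cond_exp"
    using min_order_le ge_cond_exp_mem_vals[of cond_exp] \<open>0 < cond_exp\<close> by blast
  moreover have "\<not> min_order < cond_exp"
  proof
    assume "min_order < cond_exp"
    then have "min_order \<in> vals A \<inter> {..<cond_exp}" using min_order(2) by simp
    then show False unfolding V using min_order(1) by simp
  qed
  ultimately have e: "min_order = cond_exp" by linarith
  have "A = series_above min_order"
  proof
    show "A \<subseteq> series_above min_order"
    proof
      fix f assume "f \<in> A"
      from sub_constant_coeff_mem_order_ideal[OF this]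
      have "fps_nth (f - fps_const (fps_nth f 0)) i = 0" if "i < min_order" for i
        using that unfolding order_ideal_def by blast
      then have "fps_nth f i = 0" if "0 < i" "i < min_order" for i
        using that by (metis fps_sub_nth fps_nth_fps_const diff_0_right less_irrefl)
      then show "f \<in> series_above min_order"
        unfolding series_above_def by blast
    qed
    show "series_above min_order \<subseteq> A"
    proof
      fix f :: "'k fps" assume f: "f \<in> series_above min_order"
      have "f - fps_const (fps_nth f 0) \<in> A"
      proof (rule mem_if_coeffs_zero)
        fix i assume "i < cond_exp"
        then show "fps_nth (f - fps_const (fps_nth f 0)) i = 0"
          using f unfolding e series_above_def by (cases "i = 0") auto
      qed
      from add_mem[OF this const_mem[of "fps_nth f 0"]] show "f \<in> A" by simp
    qed
  qed
  then show "2 \<le> min_order \<and> A = series_above min_order" using c2 e by simp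
next
  assume e: "2 \<le> min_order \<and> A = series_above min_order"
  have "n \<in> vals A" if "n \<ge> min_order" for n
  proof -
    have "(fps_X ^ n :: 'k fps) \<in> series_above min_order"
      unfolding series_above_def using that by (auto simp: fps_X_power_nth)
    then have "fps_X ^ n \<in> A"
      by (rule subsetD[OF equalityD2[OF conjunct2[OF e]]])
    then have "fps_X ^ n \<in> A - {0}" "n = subdegree (fps_X ^ n :: 'k fps)" by simp_all
    then show ?thesis unfolding vals_def by (rule rev_image_eqI)
  qed
  then have c: "cond_exp \<le> min_order" by (intro cond_exp_le) auto
  have "0 < cond_exp"
  proof (rule ccontr)
    assume "\<not> 0 < cond_exp"
    then have "1 \<in> vals A" by (intro ge_cond_exp_mem_vals) simp
    then show False using min_order_le[of 1] e by simp
  qed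
  then have "vals A \<inter> {..<cond_exp} = {0}"
    using c min_order_le zero_mem_vals by fastforce
  then show "card (vals A \<inter> {..<cond_exp}) = 1" by simp
qed

text \<open>The two orders are 0 and \<open>min_order\<close>; an element \<open>x\<close> of order
  \<open>min_order\<close> supplies \<open>\<alpha>\<close> as its unit part, and \<open>c\<close>
  is \<open>cond_exp\<close>.\<close>

lemma card_vals_eq_2_iff:
  "card (vals A \<inter> {..<cond_exp}) = 2 \<longleftrightarrow>
    (\<exists>\<alpha> c. \<alpha> dvd 1 \<and> min_order + 2 \<le> c \<and> c \<le> 2 * min_order \<and>
      A = two_step_series (\<alpha> * fps_X ^ min_order) c)"
proof
  assume card: "card (vals A \<inter> {..<cond_exp}) = 2"
  obtain x where x: "x \<in> A" "x \<noteq> 0" "subdegree x = min_order"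
    using min_order(2) unfolding vals_def by force
  have "vals A \<inter> {..<cond_exp} \<noteq> {}" using card by auto
  then have c0: "0 < cond_exp" by auto
  then have zero: "0 \<in> vals A \<inter> {..<cond_exp}" using zero_mem_vals by simp
  obtain y where y: "y \<in> vals A \<inter> {..<cond_exp}" "y \<noteq> 0"
  proof (rule ccontr)
    assume "\<not> thesis"
    then have "vals A \<inter> {..<cond_exp} \<subseteq> {0}" using that by blast
    from card_mono[OF _ this] show False using card by simp
  qed
  have e: "min_order \<in> vals A \<inter> {..<cond_exp}"
    using y min_order(2) min_order_le[of y] by auto
  have V: "vals A \<inter> {..<cond_exp} = {0, min_order}"
  proof (rule sym, rule card_subset_eq)
    show "card {0, min_order} = card (vals A \<inter> {..<cond_exp})" using card min_order(1) by simp
  qed (use zero e in simp_all)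
  \<comment> \<open>An order cannot equal the gap just below \<open>cond_exp\<close>, which improves
    \<open>e < c\<close> to \<open>e + 2 \<le> c\<close>.\<close>
  have "min_order \<noteq> cond_exp - 1" using pred_cond_exp_notin_vals[OF c0] e by auto
  then have c1: "min_order + 2 \<le> cond_exp" using IntD2[OF e] unfolding lessThan_iff by arith
  \<comment> \<open>The order of the square is neither 0 nor \<open>min_order\<close>, so it cannot
    lie below \<open>cond_exp\<close>.\<close>
  have "x * x \<in> A - {0}" "2 * min_order = subdegree (x * x)" using x mult_mem by simp_all
  then have "2 * min_order \<in> vals A" unfolding vals_def by (rule rev_image_eqI)
  then have c2: "cond_exp \<le> 2 * min_order"
  proof -
    have "2 * min_order \<notin> {0, min_order}" using min_order(1) by simp
    then have "\<not> 2 * min_order < cond_exp" using \<open>2 * min_order \<in> vals A\<close> unfolding V[symmetric] by simp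
    then show ?thesis by simp
  qed
  define \<alpha> where "\<alpha> = fps_shift min_order x"
  have x\<alpha>: "x = \<alpha> * fps_X ^ min_order"
    using fps_eq_X_power_mult[of min_order x] nth_less_subdegree_zero[of _ x] x(3)
    unfolding \<alpha>_def by (simp only: mult.commute)
  have "fps_nth \<alpha> 0 \<noteq> 0"
    unfolding \<alpha>_def fps_shift_nth add_0 using x by (metis nth_subdegree_nonzero)
  then have \<alpha>: "\<alpha> dvd 1" by (simp add: fps_is_unit_iff)
  have "A = two_step_series x cond_exp"
  proof
    show "two_step_series x cond_exp \<subseteq> A"
      using add_mem const_mem mult_mem x(1) tail_mem by (auto elim!: two_step_seriesE)
    show "A \<subseteq> two_step_series x cond_exp"
    proof
      fix f assume f: "f \<in> A"
      define g where "g = f - fps_const (fps_nth f 0)"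
      have gA: "g \<in> A" unfolding g_def using diff_const_mem[OF f] .
      have g0: "fps_nth g i = 0" if "i < min_order" for i
        using sub_constant_coeff_mem_order_ideal[OF f] that unfolding g_def order_ideal_def by blast
      define b where "b = fps_nth g min_order / fps_nth x min_order"
      define h where "h = g - fps_const b * x"
      have hA: "h \<in> A" unfolding h_def by (rule fps_subspace_diff[OF subspace gA x(1)])
      have xe: "fps_nth x min_order \<noteq> 0" using x by (metis nth_subdegree_nonzero)
      have h0: "fps_nth h i = 0" if "i < Suc min_order" for i
      proof (cases "i = min_order")
        case True
        then show ?thesis unfolding h_def b_def using xe by simp
      next
        case False
        then have "fps_nth g i = 0" "fps_nth x i = 0"
          using that g0[of i] nth_less_subdegree_zero[of i x] unfolding x(3) less_Suc_eq by blast+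
        then show ?thesis unfolding h_def by simp
      qed
      \<comment> \<open>After removal of the constant and of a multiple of \<open>x\<close> the
        order exceeds \<open>min_order\<close>, and the next available order is at least
        \<open>cond_exp\<close>.\<close>
      have "fps_nth h i = 0" if "i < cond_exp" for i
      proof (cases "h = 0")
        case False
        then have "subdegree h \<in> vals A" using hA unfolding vals_def by blast
        moreover have "subdegree h > min_order"
          using False h0 by (metis linorder_not_less nth_subdegree_nonzero less_Suc_eq_le)
        ultimately have "\<not> subdegree h < cond_exp"
        proof (intro notI)
          assume "subdegree h < cond_exp" "subdegree h \<in> vals A" "min_order < subdegree h"
          then have "subdegree h \<in> {0, min_order}" unfolding V[symmetric] by simp
          then show False using \<open>min_order < subdegree h\<close> by simp
        qed
        then show ?thesis using that by (intro nth_less_subdegree_zero) linarith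
      qed simp
      then have h: "h = fps_X ^ cond_exp * fps_shift cond_exp h" by (rule fps_eq_X_power_mult)
      have "f = fps_const (fps_nth f 0) + fps_const b * x + h"
        unfolding h_def g_def by simp
      then show "f \<in> two_step_series x cond_exp"
        using h two_step_seriesI by metis
    qed
  qed
  then show "\<exists>\<alpha> c. \<alpha> dvd 1 \<and> min_order + 2 \<le> c \<and> c \<le> 2 * min_order \<and>
      A = two_step_series (\<alpha> * fps_X ^ min_order) c"
    using \<alpha> c1 c2 x\<alpha> by metis
next
  assume "\<exists>\<alpha> c. \<alpha> dvd 1 \<and> min_order + 2 \<le> c \<and> c \<le> 2 * min_order \<and>
      A = two_step_series (\<alpha> * fps_X ^ min_order) c"
  then obtain \<alpha> c where \<alpha>: "\<alpha> dvd 1" and c: "min_order + 2 \<le> c"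
    and A: "A = two_step_series (\<alpha> * fps_X ^ min_order) c" by blast
  have "fps_nth \<alpha> 0 \<noteq> 0" using \<alpha> by (simp add: fps_is_unit_iff)
  then have \<alpha>0: "\<alpha> \<noteq> 0" "subdegree \<alpha> = 0" by (auto simp: subdegree_eq_0_iff)
  have "vals (two_step_series (\<alpha> * fps_X ^ min_order) c) = {0, min_order} \<union> {c..}"
    using vals_two_step_series[of "\<alpha> * fps_X ^ min_order" c] \<alpha>0 c min_order(1) by simp
  with arg_cong[OF A, of vals] have V: "vals A = {0, min_order} \<union> {c..}" by (rule trans)
  have "cond_exp \<le> c" by (rule cond_exp_le) (use V in blast)
  \<comment> \<open>Because \<open>c\<close> is at least \<open>min_order + 2\<close>, the number
    \<open>c - 1\<close> lies strictly between \<open>min_order\<close> and \<open>c\<close>; so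
    \<open>cond_exp\<close> is exactly \<open>c\<close>.\<close>
  moreover have "c - 1 \<notin> vals A" using c min_order(1) unfolding V by auto
  then have "\<not> cond_exp \<le> c - 1" using ge_cond_exp_mem_vals by blast
  ultimately have "cond_exp = c" by linarith
  then have "vals A \<inter> {..<cond_exp} = {0, min_order}"
    using c unfolding V by auto
  then show "card (vals A \<inter> {..<cond_exp}) = 2" using min_order(1) by simp
qed

end

theorem proposition6p3:
  fixes R :: "'k::field fls set" and \<mm> :: "'k fls set" and e :: nat
  assumes "infinite (UNIV :: 'k set)"
    and "subring R ring_of_type_algebra"
    and "noetherian_domain (ring_on R)"
    and "local_ring (ring_on R) \<mm>"
    and "adically_complete (ring_on R) \<mm>"
    and "krull_dim (ring_on R) = 1"
    and "range fls_const \<subseteq> R"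
    and "(\<lambda>a. \<mm> +>\<^bsub>ring_on R\<^esub> fls_const a)
           \<in> ring_iso (ring_of_type_algebra :: 'k ring) (ring_on R Quot \<mm>)"
    and "integral_closure R = range fps_to_fls"
    and "hilbert_samuel_multiplicity (ring_on R) \<mm> = real e"
  shows
    "(card (regular_trace_ideals (ring_on R)) = 2 \<longleftrightarrow>
        2 \<le> e \<and> R = fps_to_fls ` power_series_in {fps_X ^ i | i. i \<in> {e..2 * e - 1}})
     \<and>
     (card (regular_trace_ideals (ring_on R)) = 3 \<longleftrightarrow>
        (\<exists>(\<alpha> :: 'k fps) c :: nat. \<alpha> dvd 1 \<and> e + 2 \<le> c \<and> c \<le> 2 * e \<and>
           R = fps_to_fls ` power_series_in
                 (insert (\<alpha> * fps_X ^ e) {fps_X ^ i | i. i \<in> {c..c + e - 1} - {2 * e}})))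
     \<and>
     (card (regular_trace_ideals (ring_on R)) = 3 \<longleftrightarrow>
        module_length (ring_on R) (quotient_module (ring_on R) (conductor R)) = 2)"
proof -
  have R: "cring (ring_on R)"
    using assms(3) by (simp add: noetherian_domain_def domain_def)
  obtain A where A: "R = fps_to_fls ` A" "cofinite_fps_subalgebra A"
    by (rule cofinite_fps_subalgebra_if_complete[OF R assms(4,5,7,9)])
  interpret S: cofinite_fps_subalgebra A by (rule A(2))
  let ?n = "card (vals A \<inter> {..<S.cond_exp})"
  have "real S.min_order = real e"
    using S.hilbert_samuel_multiplicity_eq[OF assms(4,6)[unfolded A(1)]] assms(10)[unfolded A(1)]
    by (rule trans[OF sym])
  then have e: "S.min_order = e" by (simp only: of_nat_eq_iff)
  have e0: "0 < e" using S.min_order(1) unfolding e .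
  \<comment> \<open>The shift by one accounts for the conductor, which is a trace ideal besides
    those starting at an order below \<open>cond_exp\<close>.\<close>
  have card: "card (regular_trace_ideals (ring_on R)) = Suc m \<longleftrightarrow> ?n = m" if "m \<le> 2" for m
    unfolding A(1) S.card_regular_trace_ideals[OF assms(3)[unfolded A(1)]]
    by (rule S.card_trace_ideals[OF that])
  have card2: "card (regular_trace_ideals (ring_on R)) = 2 \<longleftrightarrow> ?n = 1"
    and card3: "card (regular_trace_ideals (ring_on R)) = 3 \<longleftrightarrow> ?n = 2"
    using card[of 1] card[of 2] by (simp_all add: eval_nat_numeral)
  have R_eq: "R = fps_to_fls ` B \<longleftrightarrow> A = B" for B
    unfolding A(1) by (rule inj_image_eq_iff[OF inj_fps_to_fls])
  have "?n = 2 \<longleftrightarrow> (\<exists>(\<alpha> :: 'k fps) c :: nat. \<alpha> dvd 1 \<and> e + 2 \<le> c \<and> c \<le> 2 * e \<and>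
      R = fps_to_fls ` power_series_in
        (insert (\<alpha> * fps_X ^ e) {fps_X ^ i | i. i \<in> {c..c + e - 1} - {2 * e}}))"
    unfolding S.card_vals_eq_2_iff e R_eq
    by (intro ex_cong1 conj_cong refl) (simp only: power_series_in_two_step)
  moreover have "?n = 1 \<longleftrightarrow>
      2 \<le> e \<and> R = fps_to_fls ` power_series_in {fps_X ^ i | i. i \<in> {e..2 * e - 1}}"
    unfolding S.card_vals_eq_1_iff e R_eq power_series_in_powers[OF e0] ..
  moreover have "module_length (ring_on R) (quotient_module (ring_on R) (conductor R)) = 2 \<longleftrightarrow> ?n = 2"
    unfolding A(1) S.module_length_conductor[OF assms(9)[unfolded A(1)]]
    by (metis enat.inject numeral_eq_enat)
  ultimately show ?thesis
    unfolding card2 card3 by (intro conjI) (simp_all only:)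
qed

end
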